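(* Let $(X,d,\mu)$ be as in the context, with $\mu$ $\delta$-Ahlfors regular. Let $(B_{i})_{i\geq1}$ be balls $B_{i}=B(x_{i},r_{i})$ with $x_{i}\in X$ and $r_{i}\to0$. Let $f$ be a dimension function such that $r\mapsto r^{-\delta}f(r)$ is monotonic, and suppose that for every ball $B\subseteq X$, \[ \mu\Big(B\cap\limsup_{i\to\infty}B_{i}^{f}\Big)=\mu(B). \] Let $(\gamma_{i})_{i\geq1}$ be such that $x_{i}+\gamma_{i}\in X$ for all $i$ and \[ \limsup_{i\to\infty}\frac{d(0,\gamma_{i})}{f(r_{i})^{1/\delta}}<\infty. \] Then for every ball $B\subseteq X$, \[ \mathcal{H}^{f}\Big(B\cap\limsup_{i\to\infty}(B_{i}+\gamma_{i})\Big)=\mathcal{H}^{f}(B). \]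
   Context: For $i=1,\dots,n$, $(X_{i},d_{i},\mu_{i})$ is a bounded locally compact metric space with a $\delta_{i}$-Ahlfors regular probability measure $\mu_{i}$ with $\operatorname{supp}\mu_{i}=X_{i}$ (i.e. $\mu_i(B(x,r))\asymp r^{\delta_i}$ for balls centred in $X_i$ of radius at most $\operatorname{diam}X_i$). $X=\prod_i X_i$, $d=\max_i d_i$, $\mu=\prod_i\mu_i$, $\delta=\sum_i\delta_i$; $\mu$ is $\delta$-Ahlfors regular. Each $X_i$ is assumed to lie in an abelian group with identity $0$ on which $d_i$ is a translation-invariant metric (e.g. $X_i=[0,1]\subset\mathbb{R}$ with $d_i(x,y)=|x-y|$), so that sums $x+\gamma$ and $d(0,\gamma)$ make sense. Balls $B(\mathbf{x},r)$ are with respect to $d$. For a ball $B=B(\mathbf{x},r)$ and dimension function $f$: $B^{f}=B(\mathbf{x},f(r)^{1/\delta})$, and $B+\mathbf{y}=B(\mathbf{x}+\mathbf{y},r)$. A dimension function is a continuous nondecreasing $f:\mathbb{R}_+\to\mathbb{R}_+$ with $f(r)\to0$ as $r\to0$; $\mathcal{H}^{f}$ is Hausdorff $f$-measure. *)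

theory Defs
  imports "HOL-Analysis.Analysis" "HOL-Probability.Probability" "HOL-Algebra.Product_Groups"
begin

definition mdiam :: "('a \<Rightarrow> 'a \<Rightarrow> real) \<Rightarrow> 'a set \<Rightarrow> real" where
  "mdiam d S = (if S = {} then 0 else (SUP p\<in>S \<times> S. d (fst p) (snd p)))"

definition ahlfors_regular ::
    "'a set \<Rightarrow> ('a \<Rightarrow> 'a \<Rightarrow> real) \<Rightarrow> 'a measure \<Rightarrow> real \<Rightarrow> bool" where
  "ahlfors_regular M d \<mu> \<delta> \<longleftrightarrow>
     (\<exists>c>0. \<exists>C>0. \<forall>x\<in>M. \<forall>r. 0 < r \<and> r \<le> mdiam d M \<longrightarrow>
        ennreal (c * r powr \<delta>) \<le> emeasure \<mu> (Metric_space.mball M d x r) \<and>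
        emeasure \<mu> (Metric_space.mball M d x r) \<le> ennreal (C * r powr \<delta>))"

definition measure_support :: "'a topology \<Rightarrow> 'a measure \<Rightarrow> 'a set" where
  "measure_support T \<mu> =
     {x \<in> topspace T. \<forall>U. openin T U \<and> x \<in> U \<longrightarrow> 0 < emeasure \<mu> U}"

locale ahlfors_probability_space = Metric_space M d + prob_space \<mu>
  for M :: "'a set" and d :: "'a \<Rightarrow> 'a \<Rightarrow> real" and \<mu> :: "'a measure" and \<delta> :: real +
  assumes bounded: "mbounded M"
    and locally_compact: "locally_compact_space mtopology"
    and sets_borel: "sets \<mu> = sets (sigma M {U. openin mtopology U})"
    and full_support: "measure_support mtopology \<mu> = M"
    and regular: "ahlfors_regular M d \<mu> \<delta>"

text \<open>The group is written multiplicatively: \<open>x \<otimes> y\<close> is the sum \<open>x + y\<close> and \<open>\<one>\<close> is the identity \<open>0\<close>.\<close>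

locale invariant_metric_group = comm_group G + Metric_space "carrier G" d
  for G :: "('a, 'b) monoid_scheme" (structure) and d :: "'a \<Rightarrow> 'a \<Rightarrow> real" +
  assumes translation_invariant:
    "\<And>x y z. \<lbrakk>x \<in> carrier G; y \<in> carrier G; z \<in> carrier G\<rbrakk> \<Longrightarrow> d (x \<otimes> z) (y \<otimes> z) = d x y"

definition max_dist ::
    "'i set \<Rightarrow> ('i \<Rightarrow> 'a \<Rightarrow> 'a \<Rightarrow> real) \<Rightarrow> ('i \<Rightarrow> 'a) \<Rightarrow> ('i \<Rightarrow> 'a) \<Rightarrow> real" where
  "max_dist I d x y = Max ((\<lambda>i. d i (x i) (y i)) ` I)"

lemma Metric_space_max_dist:
  assumes "finite I" "I \<noteq> {}" and M: "\<And>i. i \<in> I \<Longrightarrow> Metric_space (M i) (d i)"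
  shows "Metric_space (\<Pi>\<^sub>E i\<in>I. M i) (max_dist I d)"
proof
  fix x y
  obtain i where i: "i \<in> I"
    using \<open>I \<noteq> {}\<close> by blast
  have "0 \<le> d i (x i) (y i)"
    using M[OF i] by (rule Metric_space.nonneg)
  also have "\<dots> \<le> max_dist I d x y"
    unfolding max_dist_def using i \<open>finite I\<close> by simp
  finally show "0 \<le> max_dist I d x y" .
  show "max_dist I d x y = max_dist I d y x"
    unfolding max_dist_def using Metric_space.commute[OF M]
    by (intro arg_cong[where f = Max] image_cong) auto
next
  fix x y assume xy: "x \<in> (\<Pi>\<^sub>E i\<in>I. M i)" "y \<in> (\<Pi>\<^sub>E i\<in>I. M i)"
  have "max_dist I d x y = 0 \<longleftrightarrow> (\<forall>i\<in>I. d i (x i) (y i) = 0)"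
    unfolding max_dist_def using assms(1,2) Metric_space.nonneg[OF M]
    by (subst Max_eq_iff) (auto simp: image_iff order_antisym)
  also have "\<dots> \<longleftrightarrow> (\<forall>i\<in>I. x i = y i)"
    using xy Metric_space.zero[OF M] by (metis PiE_mem)
  also have "\<dots> \<longleftrightarrow> x = y"
    using xy by (auto intro: PiE_ext)
  finally show "max_dist I d x y = 0 \<longleftrightarrow> x = y" .
next
  fix x y z
  assume xyz: "x \<in> (\<Pi>\<^sub>E i\<in>I. M i)" "y \<in> (\<Pi>\<^sub>E i\<in>I. M i)" "z \<in> (\<Pi>\<^sub>E i\<in>I. M i)"
  have "d i (x i) (z i) \<le> max_dist I d x y + max_dist I d y z" if i: "i \<in> I" for i
  proof -
    have "d i (x i) (z i) \<le> d i (x i) (y i) + d i (y i) (z i)"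
      using xyz i by (intro Metric_space.triangle[OF M[OF i]]) auto
    also have "\<dots> \<le> max_dist I d x y + max_dist I d y z"
      unfolding max_dist_def using assms i by (intro add_mono Max_ge) auto
    finally show ?thesis .
  qed
  then show "max_dist I d x z \<le> max_dist I d x y + max_dist I d y z"
    using assms by (subst max_dist_def) auto
qed

text \<open>Here \<open>\<real>\<^sub>+\<close> is \<open>(0, \<infinity>)\<close>; values of \<open>f\<close> outside that interval are never used.\<close>

definition dimension_function :: "(real \<Rightarrow> real) \<Rightarrow> bool" where
  "dimension_function f \<longleftrightarrow>
     continuous_on {0<..} f \<and> mono_on {0<..} f \<and> (\<forall>r>0. 0 < f r) \<and> (f \<longlongrightarrow> 0) (at_right 0)"

text \<open>
  Sets of diameter \<open>0\<close> cost \<open>f(0) = f(0+) = 0\<close>. A finite cover is a sequence padded with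
  empty sets.
\<close>

definition hausdorff_premeasure ::
    "'a set \<Rightarrow> ('a \<Rightarrow> 'a \<Rightarrow> real) \<Rightarrow> (real \<Rightarrow> real) \<Rightarrow> real \<Rightarrow> 'a set \<Rightarrow> ennreal" where
  "hausdorff_premeasure M d f \<rho> A =
     (INF U \<in> {U :: nat \<Rightarrow> 'a set. A \<subseteq> (\<Union>j. U j) \<and>
                 (\<forall>j. U j \<subseteq> M \<and> Metric_space.mbounded M d (U j) \<and> mdiam d (U j) \<le> \<rho>)}.
        \<Sum>j. if mdiam d (U j) = 0 then 0 else ennreal (f (mdiam d (U j))))"

definition hausdorff_measure ::
    "'a set \<Rightarrow> ('a \<Rightarrow> 'a \<Rightarrow> real) \<Rightarrow> (real \<Rightarrow> real) \<Rightarrow> 'a set \<Rightarrow> ennreal" where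
  "hausdorff_measure M d f A = (SUP \<rho> \<in> {0<..}. hausdorff_premeasure M d f \<rho> A)"

end

theory Submission
  imports Defs
begin

text \<open>
  If \<open>f(t) = O(t\<^sup>\<delta>)\<close>, the shifted balls lie in comparable balls around the \<open>x\<^sub>i\<close>; their limsup set
  is then conull by a Vitali argument, and null sets exhausted by closed null sets are
  \<open>\<H>\<^sup>f\<close>-null.

  Otherwise \<open>t\<^sup>-\<^sup>\<delta> f(t)\<close> increases to infinity as \<open>t\<close> decreases to \<open>0\<close>, and the limsup set has
  infinite \<open>\<H>\<^sup>f\<close>-measure in every ball. Instead of a Cantor set carrying a mass distribution, the
  proof uses a pigeonhole: given a cover \<open>(U\<^sub>j)\<close> by small sets of finite total cost
  \<open>\<Sum> f(t\<^sub>j)\<close>, \<open>t\<^sub>j\<close> the diameter of \<open>U\<^sub>j\<close>, one finds nested shifted balls of radii \<open>r\<^sub>i\<close> in which the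
  sets \<open>U\<^sub>j\<close> meeting the ball cost at most \<open>\<kappa> f(r\<^sub>i)\<close>. By local completeness the balls have a
  common point; a set \<open>U\<^sub>j\<close> containing it would satisfy \<open>f(t\<^sub>j) \<le> \<kappa> f(r\<^sub>i)\<close> for arbitrarily small
  \<open>r\<^sub>i\<close>, which is impossible.
\<close>

text \<open>The obstacle is a mismatch of scales. With
  \<open>b\<^sub>i\<^sup>\<delta> = f(r\<^sub>i)\<close>, disjoint balls of radii
  \<open>b\<^sub>i\<close> inside a shifted ball of radius \<open>R\<close> have total weight
  \<open>\<Sum> b\<^sub>i\<^sup>\<delta>\<close> of order \<open>R\<^sup>\<delta>\<close> only,
  while the sets meeting that ball may cost up to \<open>\<kappa> f(R)\<close>, which is far more; a
  single such family could be overloaded throughout. About \<open>f(R) / R\<^sup>\<delta>\<close>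
  families are therefore stacked in the same ball. There is room for them because
  \<open>r\<^sub>i / b\<^sub>i\<close> tends to \<open>0\<close>, so that the shifted balls
  themselves take up a negligible part of the volume. A set of diameter \<open>t\<close> may meet
  many balls of the stack. Where \<open>b\<^sub>i \<le> t\<close>, the volume it can charge is of
  order \<open>t\<^sup>\<delta>\<close> per family, and its cost pays for this because
  \<open>f(t) / t\<^sup>\<delta> \<ge> f(R) / R\<^sup>\<delta>\<close> for \<open>t \<le> R\<close>.
  Where \<open>b\<^sub>i > t\<close>, separation leaves one ball, charged at most
  \<open>f(t)\<close>. The choice \<open>\<kappa> < 1\<close> keeps the argument going: a set
  meeting a ball of load at most \<open>\<kappa> f(r\<^sub>i)\<close> has diameter below
  \<open>r\<^sub>i\<close>, so the comparison is available at the next stage.\<close>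

section \<open>Covering and counting in regular spaces\<close>

text \<open>A ball of largest radius absorbs, after tripling, every ball that meets it; the balls
  disjoint from it form a smaller family, to which induction applies.\<close>

lemma (in Metric_space) finite_Vitali:
  fixes R :: "'i \<Rightarrow> real"
  assumes "finite I"
  shows "\<exists>J\<subseteq>I. disjoint_family_on (\<lambda>i. mball (x i) (R i)) J \<and>
           (\<Union>i\<in>I. mball (x i) (R i)) \<subseteq> (\<Union>i\<in>J. mball (x i) (3 * R i))"
  using assms
proof (induction "card I" arbitrary: I rule: less_induct)
  case less
  show ?case
  proof (cases "I = {}")
    case False
    then obtain i where i: "i \<in> I" "\<And>k. k \<in> I \<Longrightarrow> R k \<le> R i"
      using less.prems Max_in[of "R ` I"] Max_ge[of "R ` I"] by fastforce
    define I' where "I' = {k \<in> I. k \<noteq> i \<and> mball (x k) (R k) \<inter> mball (x i) (R i) = {}}"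
    have "card I' < card I"
      using i less.prems unfolding I'_def by (intro psubset_card_mono) auto
    moreover have "finite I'"
      using less.prems unfolding I'_def by auto
    ultimately obtain J where J: "J \<subseteq> I'" "disjoint_family_on (\<lambda>i. mball (x i) (R i)) J"
        "(\<Union>i\<in>I'. mball (x i) (R i)) \<subseteq> (\<Union>i\<in>J. mball (x i) (3 * R i))"
      using less.hyps by meson
    have "disjoint_family_on (\<lambda>i. mball (x i) (R i)) (insert i J)"
      using J unfolding disjoint_family_on_def I'_def by blast
    moreover have "mball (x k) (R k) \<subseteq> (\<Union>i\<in>insert i J. mball (x i) (3 * R i))" if k: "k \<in> I" for k
    proof (cases "k \<in> I'")
      case False
      have "mball (x k) (R k) \<subseteq> mball (x i) (3 * R i)"
      proof
        fix p assume p: "p \<in> mball (x k) (R k)"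
        show "p \<in> mball (x i) (3 * R i)"
        proof (cases "k = i")
          case True
          then have "x i \<in> M" "p \<in> M" "d (x i) p < R i" using p by auto
          moreover from this have "d (x i) p < 3 * R i" using nonneg[of "x i" p] by linarith
          ultimately show ?thesis by simp
        next
          case ne: False
          obtain q where q: "q \<in> mball (x k) (R k)" "q \<in> mball (x i) (R i)"
            using False k ne unfolding I'_def by blast
          have "d (x i) p \<le> d (x i) q + d q p" "d q p \<le> d q (x k) + d (x k) p"
            using p q by (auto intro!: triangle)
          then show ?thesis
            using p q i(2)[OF k] commute[of q "x k"] by auto
        qed
      qed
      then show ?thesis by blast
    qed (use J in blast)
    ultimately show ?thesis
      using J(1) i(1) unfolding I'_def by (intro exI[of _ "insert i J"]) auto
  qed (auto simp: disjoint_family_on_def)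
qed

text \<open>The upper bound is asked at all radii because it is applied to enlarged balls; for a
  finite measure this only costs a larger \<open>C\<close>. Measurability is asked of balls alone,
  as these are boxes in a product.\<close>

locale regular_metric_measure = Metric_space M d + finite_measure \<mu>
  for M :: "'a set" and d :: "'a \<Rightarrow> 'a \<Rightarrow> real" and \<mu> :: "'a measure" +
  fixes c C D \<delta> :: real
  assumes c_pos: "0 < c" and C_pos: "0 < C" and D_pos: "0 < D" and \<delta>_pos: "0 < \<delta>"
    and mball_sets [measurable]: "mball y s \<in> sets \<mu>"
    and lower: "\<lbrakk>y \<in> M; 0 < s; s \<le> D\<rbrakk> \<Longrightarrow> c * s powr \<delta> \<le> measure \<mu> (mball y s)"
    and upper: "\<lbrakk>y \<in> M; 0 < s\<rbrakk> \<Longrightarrow> measure \<mu> (mball y s) \<le> C * s powr \<delta>"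
begin

text \<open>Balls of radius \<open>\<epsilon> / 2\<close> about \<open>\<epsilon>\<close>-separated
  points are disjoint, so their volumes add up inside \<open>V\<close>.\<close>

lemma card_separated_le:
  assumes "finite S" "S \<subseteq> M" "pairwise (\<lambda>s t. \<epsilon> \<le> d s t) S" "0 < \<epsilon>" "\<epsilon> \<le> D"
    and V: "V \<in> sets \<mu>" "\<And>s. s \<in> S \<Longrightarrow> mball s (\<epsilon> / 2) \<subseteq> V"
  shows "card S * (c * (\<epsilon> / 2) powr \<delta>) \<le> measure \<mu> V"
proof -
  have "disjoint_family_on (\<lambda>s. mball s (\<epsilon> / 2)) S"
    unfolding disjoint_family_on_def
  proof (intro ballI impI)
    fix s t assume st: "s \<in> S" "t \<in> S" "s \<noteq> t"
    show "mball s (\<epsilon> / 2) \<inter> mball t (\<epsilon> / 2) = {}"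
    proof (rule ccontr)
      assume "\<not> ?thesis"
      then obtain p where p: "p \<in> mball s (\<epsilon> / 2)" "p \<in> mball t (\<epsilon> / 2)" by blast
      then have "d s t \<le> d s p + d p t" by (intro triangle) auto
      then show False
        using p pairwiseD[OF assms(3) st] commute[of p t] by simp
    qed
  qed
  then have "(\<Sum>s\<in>S. measure \<mu> (mball s (\<epsilon> / 2))) = measure \<mu> (\<Union>s\<in>S. mball s (\<epsilon> / 2))"
    using assms(1) by (intro finite_measure_finite_Union[symmetric]) auto
  also have "\<dots> \<le> measure \<mu> V"
    using V by (intro finite_measure_mono) auto
  finally have "(\<Sum>s\<in>S. measure \<mu> (mball s (\<epsilon> / 2))) \<le> measure \<mu> V" .
  moreover have "(\<Sum>s\<in>S. c * (\<epsilon> / 2) powr \<delta>) \<le> (\<Sum>s\<in>S. measure \<mu> (mball s (\<epsilon> / 2)))"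
    using assms by (intro sum_mono lower) auto
  ultimately show ?thesis by simp
qed

text \<open>The volume count bounds the size of separated sets, so one of greatest cardinality
  exists; a point far from all its members could be added to it.\<close>

lemma finite_net:
  assumes "A \<subseteq> M" "0 < \<epsilon>" "\<epsilon> \<le> D"
  obtains S where "finite S" "S \<subseteq> A" "pairwise (\<lambda>s t. \<epsilon> \<le> d s t) S"
    "A \<subseteq> (\<Union>s\<in>S. mball s \<epsilon>)"
proof -
  define P where "P S \<longleftrightarrow> finite S \<and> S \<subseteq> A \<and> pairwise (\<lambda>s t. \<epsilon> \<le> d s t) S" for S
  define K where "K = c * (\<epsilon> / 2) powr \<delta>"
  have K: "0 < K" using assms c_pos by (simp add: K_def)
  have bound: "card S < Suc (nat \<lfloor>measure \<mu> (space \<mu>) / K\<rfloor>)" if "P S" for S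
  proof -
    have "card S * K \<le> measure \<mu> (space \<mu>)"
      unfolding K_def using that assms by (intro card_separated_le) (auto simp: P_def sets.sets_into_space)
    then have "real (card S) \<le> measure \<mu> (space \<mu>) / K"
      using K by (simp add: field_simps)
    then show ?thesis by linarith
  qed
  have "P {}" by (simp add: P_def)
  then obtain S where S: "P S" "\<And>T. P T \<Longrightarrow> card T \<le> card S"
    using ex_has_greatest_nat[of P "{}" card] bound by (metis less_imp_le)
  have "A \<subseteq> (\<Union>s\<in>S. mball s \<epsilon>)"
  proof (rule ccontr)
    assume "\<not> ?thesis"
    then obtain a where a: "a \<in> A" "\<And>s. s \<in> S \<Longrightarrow> a \<notin> mball s \<epsilon>" by blast
    have far: "\<epsilon> \<le> d s a" "\<epsilon> \<le> d a s" if "s \<in> S" for s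
      using a that S(1) assms(1) commute[of a s] by (force simp: P_def)+
    have "a \<notin> S" using far(1)[of a] a(1) assms by auto
    moreover have "P (insert a S)"
      using S(1) a far by (auto simp: P_def pairwise_insert)
    ultimately show False
      using S(2)[of "insert a S"] S(1) by (simp add: P_def)
  qed
  then show ?thesis using that S(1) by (auto simp: P_def)
qed

text \<open>Finite nets at the scales \<open>D / Suc n\<close> give a countable base of balls, so
  measurability passes from balls to open sets.\<close>

lemma openin_sets:
  assumes "openin mtopology V"
  shows "V \<in> sets \<mu>"
proof -
  define \<epsilon> where "\<epsilon> n = D / real (Suc n)" for n
  have \<epsilon>: "0 < \<epsilon> n" "\<epsilon> n \<le> D" for n
    using D_pos by (auto simp: \<epsilon>_def field_simps)
  have "\<exists>S. finite S \<and> S \<subseteq> M \<and> M \<subseteq> (\<Union>s\<in>S. mball s (\<epsilon> n))" for n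
    using finite_net[OF order_refl \<epsilon>(1,2)] by metis
  then obtain S where S: "\<And>n. finite (S n)" "\<And>n. S n \<subseteq> M" "\<And>n. M \<subseteq> (\<Union>s\<in>S n. mball s (\<epsilon> n))"
    by metis
  have "V = (\<Union>n. \<Union>s\<in>{s \<in> S n. mball s (\<epsilon> n) \<subseteq> V}. mball s (\<epsilon> n))" (is "V = ?U")
  proof
    show "V \<subseteq> ?U"
    proof
      fix p assume p: "p \<in> V"
      obtain e where e: "0 < e" "mball p e \<subseteq> V" "p \<in> M"
        using assms p unfolding openin_mtopology by blast
      obtain n where n: "2 * D / e < real n" using reals_Archimedean2 by blast
      then have "2 * D < e * Suc n" using e by (simp add: field_simps)
      then have en: "2 * \<epsilon> n < e" using e by (simp add: \<epsilon>_def field_simps)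
      obtain s where s: "s \<in> S n" "p \<in> mball s (\<epsilon> n)" using S(3) e(3) by blast
      have "mball s (\<epsilon> n) \<subseteq> mball p e"
        using s en by (intro mball_subset) auto
      then show "p \<in> ?U" using s e by blast
    qed
  qed auto
  also have "\<dots> \<in> sets \<mu>"
    using S(1) by (intro sets.countable_UN sets.finite_UN) auto
  finally show ?thesis .
qed

text \<open>Almost every point of \<open>V\<close> lies in balls of arbitrarily large index, whose
  \<open>L\<close>-fold enlargements eventually fit into \<open>V\<close>. Finitely many of these
  cover more than half of \<open>V\<close> (the factor 2), and the finite Vitali lemma triples them
  (the factor 3). Disjointness is obtained for the enlarged balls, though the weight counts only
  \<open>\<beta> i\<close>.\<close>

lemma disjoint_balls_in_open:
  fixes x :: "nat \<Rightarrow> 'a" and \<beta> :: "nat \<Rightarrow> real"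
  assumes V: "openin mtopology V"
    and x: "\<And>i. x i \<in> M" and \<beta>: "\<And>i. 0 < \<beta> i" "\<beta> \<longlonglongrightarrow> 0" and lam: "1 \<le> L"
    and full: "V - limsup (\<lambda>i. mball (x i) (\<beta> i)) \<in> null_sets \<mu>"
  obtains J where "finite J" "\<And>i. i \<in> J \<Longrightarrow> m \<le> i" "\<And>i. i \<in> J \<Longrightarrow> mball (x i) (L * \<beta> i) \<subseteq> V"
    "disjoint_family_on (\<lambda>i. mball (x i) (L * \<beta> i)) J"
    "measure \<mu> V \<le> 2 * C * (3 * L) powr \<delta> * (\<Sum>i\<in>J. \<beta> i powr \<delta>)"
proof (cases "measure \<mu> V = 0")
  case True
  then show ?thesis by (intro that[of "{}"]) (auto simp: disjoint_family_on_def)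
next
  case False
  have O_sets [measurable]: "V \<in> sets \<mu>" using openin_sets V by blast
  define W where "W i = mball (x i) (L * \<beta> i)" for i
  define I where "I = {i. m \<le> i \<and> W i \<subseteq> V}"
  define A where "A n = (\<Union>i\<in>I \<inter> {..n}. W i)" for n
  have W_sets [measurable]: "W i \<in> sets \<mu>" for i unfolding W_def by simp
  have A_sets: "A n \<in> sets \<mu>" for n unfolding A_def by (intro sets.finite_UN) auto
  have "V - (\<Union>n. A n) \<subseteq> V - limsup (\<lambda>i. mball (x i) (\<beta> i))"
  proof
    fix p assume p: "p \<in> V - (\<Union>n. A n)"
    obtain e where e: "0 < e" "mball p e \<subseteq> V" "p \<in> M"
      using V p unfolding openin_mtopology by blast
    \<comment> \<open>The factor 2 accounts for the diameter: a ball of radius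
      \<open>L * \<beta> i\<close> containing \<open>p\<close> lies in the ball of radius
      \<open>2 * L * \<beta> i\<close> about \<open>p\<close>.\<close>
    have "(\<lambda>i. 2 * L * \<beta> i) \<longlonglongrightarrow> 2 * L * 0" by (intro tendsto_intros \<beta>)
    then have "\<forall>\<^sub>F i in sequentially. 2 * L * \<beta> i < e"
      using e(1) by (intro order_tendstoD(2)) auto
    then obtain k where k: "\<And>i. k \<le> i \<Longrightarrow> 2 * L * \<beta> i < e"
      unfolding eventually_sequentially by blast
    have "p \<notin> mball (x i) (\<beta> i)" if i: "max k m \<le> i" for i
    proof
      assume pi: "p \<in> mball (x i) (\<beta> i)"
      have le: "\<beta> i \<le> L * \<beta> i" using lam \<beta>(1)[of i] by simp
      have "d (x i) p + L * \<beta> i \<le> e"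
        using pi k[of i] i le by auto
      then have "W i \<subseteq> mball p e" unfolding W_def using e by (intro mball_subset) auto
      then have "i \<in> I" using e i by (auto simp: I_def)
      moreover have "p \<in> W i"
        using pi le mball_subset_concentric[of "\<beta> i" "L * \<beta> i" "x i"] unfolding W_def by blast
      ultimately show False using p unfolding A_def by blast
    qed
    then have "p \<notin> limsup (\<lambda>i. mball (x i) (\<beta> i))"
      unfolding limsup_INF_SUP by blast
    then show "p \<in> V - limsup (\<lambda>i. mball (x i) (\<beta> i))" using p by blast
  qed
  then have "V - (\<Union>n. A n) \<in> null_sets \<mu>"
    using full A_sets by (intro null_sets_subset[OF full]) auto
  then have "measure \<mu> (V - (\<Union>n. A n)) = 0"
    by (simp add: measure_def null_setsD1)
  moreover have "(\<Union>n. A n) \<subseteq> V" unfolding A_def I_def by blast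
  ultimately have eq: "measure \<mu> (\<Union>n. A n) = measure \<mu> V"
    using A_sets by (subst (asm) finite_measure_Diff) auto
  have "(\<lambda>n. measure \<mu> (A n)) \<longlonglongrightarrow> measure \<mu> (\<Union>n. A n)"
    using A_sets by (intro finite_Lim_measure_incseq) (auto intro!: incseq_SucI simp: A_def)
  moreover have "measure \<mu> V / 2 < measure \<mu> (\<Union>n. A n)"
    using False unfolding eq by (simp add: zero_less_measure_iff)
  ultimately have "\<forall>\<^sub>F n in sequentially. measure \<mu> V / 2 < measure \<mu> (A n)"
    by (rule order_tendstoD(1))
  then obtain n where n: "measure \<mu> V / 2 < measure \<mu> (A n)"
    unfolding eventually_sequentially by blast
  obtain J where J: "J \<subseteq> I \<inter> {..n}" "disjoint_family_on W J"
      "A n \<subseteq> (\<Union>i\<in>J. mball (x i) (3 * (L * \<beta> i)))"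
    using finite_Vitali[of "I \<inter> {..n}" x "\<lambda>i. L * \<beta> i"] unfolding A_def W_def by auto
  have fin: "finite J" using J(1) finite_subset by blast
  have "measure \<mu> (A n) \<le> measure \<mu> (\<Union>i\<in>J. mball (x i) (3 * (L * \<beta> i)))"
    using J fin by (intro finite_measure_mono sets.finite_UN) auto
  also have "\<dots> \<le> (\<Sum>i\<in>J. measure \<mu> (mball (x i) (3 * (L * \<beta> i))))"
    using fin by (intro finite_measure_subadditive_finite) auto
  also have "\<dots> \<le> (\<Sum>i\<in>J. C * (3 * L * \<beta> i) powr \<delta>)"
    using x \<beta>(1) lam upper[of _ "3 * L * \<beta> _"] by (intro sum_mono) (simp add: mult.assoc)
  also have "\<dots> = C * (3 * L) powr \<delta> * (\<Sum>i\<in>J. \<beta> i powr \<delta>)"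
    using lam \<beta>(1) by (simp add: powr_mult sum_distrib_left mult.assoc less_imp_le)
  finally have "measure \<mu> V \<le> 2 * C * (3 * L) powr \<delta> * (\<Sum>i\<in>J. \<beta> i powr \<delta>)"
    using n by (simp add: mult.assoc)
  then show ?thesis
    using that[of J] J fin unfolding I_def W_def by blast
qed

end

section \<open>Diameters and Hausdorff premeasures\<close>

context Metric_space
begin

lemma mdiam_nonneg:
  assumes "mbounded S"
  shows "0 \<le> mdiam d S"
proof (cases "S = {}")
  case False
  then obtain p where p: "p \<in> S" by blast
  obtain B where "\<forall>x\<in>S. \<forall>y\<in>S. d x y \<le> B"
    using assms by (auto simp: mbounded_alt)
  then have "bdd_above ((\<lambda>p. d (fst p) (snd p)) ` (S \<times> S))"
    by (intro bdd_aboveI[where M = B]) auto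
  from cSUP_upper[OF _ this, of "(p, p)"] have "d p p \<le> mdiam d S"
    using p False unfolding mdiam_def by simp
  then show ?thesis using nonneg[of p p] by linarith
qed (simp add: mdiam_def)

lemma dist_le_mdiam:
  assumes "mbounded S" "p \<in> S" "q \<in> S"
  shows "d p q \<le> mdiam d S"
proof -
  obtain B where "\<forall>x\<in>S. \<forall>y\<in>S. d x y \<le> B"
    using assms by (auto simp: mbounded_alt)
  then have "bdd_above ((\<lambda>p. d (fst p) (snd p)) ` (S \<times> S))"
    by (intro bdd_aboveI[where M = B]) auto
  from cSUP_upper[OF _ this, of "(p, q)"] show ?thesis
    using assms unfolding mdiam_def by auto
qed

lemma mdiam_mball_le:
  assumes "0 \<le> \<epsilon>"
  shows "mdiam d (mball s \<epsilon>) \<le> 2 * \<epsilon>"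
proof (cases "mball s \<epsilon> = {}")
  case False
  have "d p q \<le> 2 * \<epsilon>" if "p \<in> mball s \<epsilon>" "q \<in> mball s \<epsilon>" for p q
  proof -
    have "d p q \<le> d p s + d s q" using that by (intro triangle) auto
    then show ?thesis using that commute[of p s] by simp
  qed
  then have "(SUP p\<in>mball s \<epsilon> \<times> mball s \<epsilon>. d (fst p) (snd p)) \<le> 2 * \<epsilon>"
    using False by (intro cSUP_least) (auto simp del: in_mball)
  then show ?thesis using False by (simp add: mdiam_def)
qed (use assms in \<open>simp add: mdiam_def\<close>)

text \<open>Covers optimal up to \<open>e / 2 ^ Suc n\<close> are merged into one sequence by the
  pairing function. A finite right-hand side makes every term finite, which such near-optimal covers
  require.\<close>

lemma hausdorff_premeasure_UN:
  "hausdorff_premeasure M d f \<rho> (\<Union>n. A n) \<le> (\<Sum>n. hausdorff_premeasure M d f \<rho> (A n :: 'a set))"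
proof (rule ennreal_le_epsilon)
  let ?H = "hausdorff_premeasure M d f \<rho>"
  let ?cost = "\<lambda>U. if mdiam d U = 0 then 0 else ennreal (f (mdiam d U))"
  fix e :: real assume fin: "(\<Sum>n. ?H (A n)) < Orderings.top_class.top" and e: "0 < e"
  define cover where "cover n U \<longleftrightarrow> A n \<subseteq> (\<Union>j. U j) \<and>
      (\<forall>j. U j \<subseteq> M \<and> mbounded (U j) \<and> mdiam d (U j) \<le> \<rho>)" for n and U :: "nat \<Rightarrow> 'a set"
  have "\<exists>U. cover n U \<and> (\<Sum>j. ?cost (U j)) \<le> ?H (A n) + ennreal (e * (1/2) ^ Suc n)" for n
  proof -
    have "?H (A n) \<noteq> Orderings.top_class.top"
      using ennreal_suminf_lessD[OF fin, of n] by auto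
    moreover have "0 < e * (1/2) ^ Suc n" using e by simp
    ultimately have "?H (A n) < ?H (A n) + ennreal (e * (1/2) ^ Suc n)"
      by (cases "?H (A n)" rule: ennreal_cases)
        (simp_all add: ennreal_plus[symmetric] ennreal_less_iff del: ennreal_plus power_Suc)
    moreover have "?H (A n) = (INF U\<in>Collect (cover n). \<Sum>j. ?cost (U j))"
      unfolding hausdorff_premeasure_def cover_def by simp
    ultimately obtain U where "cover n U" "(\<Sum>j. ?cost (U j)) < ?H (A n) + ennreal (e * (1/2) ^ Suc n)"
      by (auto simp: INF_less_iff)
    then show ?thesis by (intro exI[of _ U]) auto
  qed
  then have "\<forall>n. \<exists>U. cover n U \<and> (\<Sum>j. ?cost (U j)) \<le> ?H (A n) + ennreal (e * (1/2) ^ Suc n)"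
    by (rule allI)
  from choice[OF this] obtain U where U0: "\<And>n. cover n (U n)"
      and U3: "\<And>n. (\<Sum>j. ?cost (U n j)) \<le> ?H (A n) + ennreal (e * (1/2) ^ Suc n)"
    by (elim exE) auto
  have U: "A n \<subseteq> (\<Union>j. U n j)" "U n j \<subseteq> M \<and> mbounded (U n j) \<and> mdiam d (U n j) \<le> \<rho>" for n j
    using U0[of n] unfolding cover_def by auto
  define V where "V i = case_prod U (prod_decode i)" for i
  have "(\<Union>n. A n) \<subseteq> (\<Union>i. V i)"
  proof
    fix p assume "p \<in> (\<Union>n. A n)"
    then obtain n j where "p \<in> U n j" using U(1) by blast
    then have "p \<in> V (prod_encode (n, j))" by (simp add: V_def)
    then show "p \<in> (\<Union>i. V i)" by blast
  qed
  moreover have "V i \<subseteq> M \<and> mbounded (V i) \<and> mdiam d (V i) \<le> \<rho>" for i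
    using U(2) by (simp add: V_def split: prod.split)
  ultimately have "?H (\<Union>n. A n) \<le> (\<Sum>i. ?cost (V i))"
    unfolding hausdorff_premeasure_def by (intro INF_lower) auto
  also have "\<dots> = (\<Sum>n. \<Sum>j. ?cost (U n j))"
    unfolding V_def
    by (rule suminf_ennreal_2dimen[where f = "\<lambda>p. ?cost (case_prod U p)"]) (simp only: prod.case)
  also have "\<dots> \<le> (\<Sum>n. ?H (A n) + ennreal (e * (1/2) ^ Suc n))"
    using U3 by (intro suminf_le) auto
  also have "\<dots> = (\<Sum>n. ?H (A n)) + (\<Sum>n. ennreal e * ennreal ((1/2) ^ Suc n))"
    using e by (subst suminf_add[symmetric])
      (auto simp del: ennreal_suminf_cmult simp add: ennreal_mult[symmetric])
  also have "(\<Sum>n. ennreal e * ennreal ((1/2) ^ Suc n)) = ennreal e"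
    unfolding ennreal_suminf_cmult
    by (subst suminf_ennreal_eq[OF zero_le_power power_half_series]) auto
  finally show "?H (\<Union>n. A n) \<le> (\<Sum>n. ?H (A n)) + ennreal e" .
qed

lemma hausdorff_measure_mono:
  "A \<subseteq> B \<Longrightarrow> hausdorff_measure M d f A \<le> hausdorff_measure M d f B"
  unfolding hausdorff_measure_def hausdorff_premeasure_def
  by (intro SUP_mono' INF_superset_mono) auto

text \<open>The measure is the supremum over the scales, so a null set has premeasure
  \<open>0\<close> at every scale. Subadditivity at a fixed scale, for the sequence
  \<open>A, N 0, N 1, ...\<close>, then suffices, without any measurability.\<close>

lemma hausdorff_measure_eq_of_null_cover:
  assumes null: "\<And>n :: nat. hausdorff_measure M d f (N n) = 0"
    and sub: "A \<subseteq> B" "B \<subseteq> A \<union> (\<Union>n. N n)"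
  shows "hausdorff_measure M d f A = hausdorff_measure M d f B"
proof (rule antisym[OF hausdorff_measure_mono[OF sub(1)]])
  have "hausdorff_premeasure M d f \<rho> B \<le> hausdorff_measure M d f A" if \<rho>: "0 < \<rho>" for \<rho>
  proof -
    let ?H = "hausdorff_premeasure M d f \<rho>"
    have le: "?H S \<le> hausdorff_measure M d f S" for S
      unfolding hausdorff_measure_def using \<rho> by (intro SUP_upper) auto
    have H0: "?H (N k) = 0" for k using le[of "N k"] null by simp
    have "A \<subseteq> (\<Union>n. case_nat A N n)" "N k \<subseteq> (\<Union>n. case_nat A N n)" for k
      using UN_upper[of 0 UNIV "case_nat A N"] UN_upper[of "Suc k" UNIV "case_nat A N"] by auto
    then have "A \<union> (\<Union>n. N n) \<subseteq> (\<Union>n. case_nat A N n)"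
      by (intro Un_least UN_least)
    then have "B \<subseteq> (\<Union>n. case_nat A N n)" by (rule order_trans[OF sub(2)])
    then have "?H B \<le> ?H (\<Union>n. case_nat A N n)"
      unfolding hausdorff_premeasure_def by (intro INF_superset_mono) auto
    also have "\<dots> \<le> (\<Sum>n. ?H (case_nat A N n))" by (rule hausdorff_premeasure_UN)
    also have "\<dots> = (\<Sum>n\<in>{0}. ?H (case_nat A N n))"
      using H0 by (intro suminf_finite) (auto split: nat.splits)
    also have "\<dots> \<le> hausdorff_measure M d f A" using le by simp
    finally show ?thesis .
  qed
  then show "hausdorff_measure M d f B \<le> hausdorff_measure M d f A"
    unfolding hausdorff_measure_def[of M d f B] by (intro SUP_least) auto
qed

lemma hausdorff_premeasure_le_card:
  fixes f :: "real \<Rightarrow> real"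
  assumes f: "mono_on {0<..} f" "\<And>t. 0 < t \<Longrightarrow> 0 \<le> f t"
    and S: "finite S" "F \<subseteq> (\<Union>s\<in>S. mball s \<epsilon>)" and \<epsilon>: "0 < \<epsilon>" "2 * \<epsilon> \<le> \<rho>"
  shows "hausdorff_premeasure M d f \<rho> F \<le> ennreal (card S * f (2 * \<epsilon>))"
proof -
  let ?cost = "\<lambda>U. if mdiam d U = 0 then 0 else ennreal (f (mdiam d U))"
  obtain h where h: "bij_betw h {0..<card S} S"
    using ex_bij_betw_nat_finite[OF S(1)] by blast
  define U where "U j = (if j < card S then mball (h j) \<epsilon> else {})" for j
  have "F \<subseteq> (\<Union>j. U j)"
  proof
    fix p assume "p \<in> F"
    then obtain s where s: "s \<in> S" "p \<in> mball s \<epsilon>" using S(2) by blast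
    then obtain j where "j < card S" "h j = s"
      using h unfolding bij_betw_def by (metis atLeastLessThan_iff imageE)
    then have "p \<in> U j" using s by (simp add: U_def)
    then show "p \<in> (\<Union>j. U j)" by blast
  qed
  moreover have diam: "mdiam d (U j) \<le> 2 * \<epsilon>" for j
    using mdiam_mball_le[of \<epsilon> "h j"] \<epsilon> by (auto simp: U_def) (simp add: mdiam_def)
  moreover have bdd: "U j \<subseteq> M \<and> mbounded (U j)" for j
    using mball_subset_mspace by (auto simp: U_def)
  ultimately have "hausdorff_premeasure M d f \<rho> F \<le> (\<Sum>j. ?cost (U j))"
    unfolding hausdorff_premeasure_def using \<epsilon> by (intro INF_lower) (auto intro: order_trans)
  also have "\<dots> = (\<Sum>j<card S. ?cost (U j))"
    by (intro suminf_finite) (auto simp: U_def mdiam_def)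
  also have "\<dots> \<le> (\<Sum>j<card S. ennreal (f (2 * \<epsilon>)))"
  proof (intro sum_mono)
    fix j
    have "0 < mdiam d (U j)" if "mdiam d (U j) \<noteq> 0"
      using mdiam_nonneg[of "U j"] bdd that by (simp add: less_le)
    then show "?cost (U j) \<le> ennreal (f (2 * \<epsilon>))"
      using monotone_onD[OF f(1), of "mdiam d (U j)" "2 * \<epsilon>"] diam[of j] \<epsilon>
      by (auto intro: ennreal_leI)
  qed
  also have "\<dots> = ennreal (card S * f (2 * \<epsilon>))"
    using f(2)[of "2 * \<epsilon>"] \<epsilon> by (simp add: ennreal_mult ennreal_of_nat_eq_real_of_nat)
  finally show ?thesis .
qed

end

section \<open>Closed null sets and limsup sets of comparable balls\<close>

context regular_metric_measure
begin

text \<open>The neighbourhoods decrease to \<open>F\<close> because \<open>F\<close> is closed, and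
  a finite measure is continuous from above.\<close>

lemma measure_neighbourhoods:
  assumes "closedin mtopology F"
  shows "(\<lambda>n. measure \<mu> (\<Union>q\<in>F. mball q (D / Suc n))) \<longlonglongrightarrow> measure \<mu> F"
proof -
  let ?V = "\<lambda>n. \<Union>q\<in>F. mball q (D / Suc n)"
  have sub: "F \<subseteq> M" using closedin_subset[OF assms] by simp
  have V: "?V n \<in> sets \<mu>" for n by (intro openin_sets openin_Union) auto
  have "(\<lambda>n. measure \<mu> (?V n)) \<longlonglongrightarrow> measure \<mu> (\<Inter>n. ?V n)"
  proof (rule finite_Lim_measure_decseq)
    show "decseq ?V"
      unfolding decseq_def
    proof (intro allI impI UN_mono order_refl mball_subset_concentric)
      show "D / Suc n \<le> D / Suc m" if "m \<le> n" for m n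
        using D_pos that by (intro divide_left_mono) auto
    qed
  qed (use V in auto)
  moreover have "(\<Inter>n. ?V n) = F"
  proof
    show "F \<subseteq> (\<Inter>n. ?V n)" using sub D_pos by force
    show "(\<Inter>n. ?V n) \<subseteq> F"
    proof (rule ccontr)
      assume "\<not> ?thesis"
      then obtain p where p: "\<And>n. p \<in> ?V n" "p \<notin> F" by blast
      then have "p \<in> M - F" by auto
      then obtain e where e: "0 < e" "disjnt F (mball p e)"
        using assms unfolding closedin_metric by blast
      obtain n where "D / e < real n" using reals_Archimedean2 by blast
      then have "D < e * Suc n" using e by (simp add: field_simps)
      then have n: "D / Suc n < e" by (simp add: field_simps)
      obtain q where q: "q \<in> F" "p \<in> mball q (D / Suc n)" using p(1)[of n] by blast
      then have "q \<in> mball p e" using n commute[of p q] by auto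
      then show False using e q by (auto simp: disjnt_iff)
    qed
  qed
  ultimately show ?thesis by simp
qed

text \<open>An \<open>\<epsilon>\<close>-net of \<open>F\<close> consists of separated points whose
  half-radius balls lie in a neighbourhood of small measure. Its balls cost
  \<open>f (2 * \<epsilon>)\<close> each, which is at most a constant times the volume of a
  half-radius ball, so the total cost tends to \<open>0\<close>.\<close>

lemma hausdorff_measure_closed_null:
  assumes F: "closedin mtopology F" "measure \<mu> F = 0"
    and f: "mono_on {0<..} f" "\<And>t. 0 < t \<Longrightarrow> 0 \<le> f t"
    and A: "\<And>t. \<lbrakk>0 < t; t \<le> 1\<rbrakk> \<Longrightarrow> f t \<le> A * t powr \<delta>"
  shows "hausdorff_measure M d f F = 0"
proof -
  have "hausdorff_premeasure M d f \<rho> F = 0" if \<rho>: "0 < \<rho>" for \<rho>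
  proof -
    let ?V = "\<lambda>n. \<Union>q\<in>F. mball q (D / Suc n)"
    \<comment> \<open>The ratio of the cost bound \<open>A * (2 * \<epsilon>) powr \<delta>\<close>
      to the volume bound \<open>c * (\<epsilon> / 2) powr \<delta>\<close>.\<close>
    define K where "K = A * 4 powr \<delta> / c"
    have sub: "F \<subseteq> M" using closedin_subset[OF F(1)] by simp
    have A0: "0 \<le> A" using A[of 1] f(2)[of 1] by simp
    have "(\<lambda>n. ennreal (K * measure \<mu> (?V n))) \<longlonglongrightarrow> ennreal (K * measure \<mu> F)"
      by (intro tendsto_intros measure_neighbourhoods F)
    moreover have "\<forall>\<^sub>F n in sequentially. hausdorff_premeasure M d f \<rho> F \<le> ennreal (K * measure \<mu> (?V n))"
    proof -
      have "(\<lambda>n. 2 * (D * inverse (Suc n))) \<longlonglongrightarrow> 2 * (D * 0)"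
        by (intro tendsto_intros LIMSEQ_inverse_real_of_nat)
      then have "\<forall>\<^sub>F n in sequentially. 2 * (D * inverse (Suc n)) < min \<rho> 1"
        using \<rho> by (intro order_tendstoD(2)) auto
      then show ?thesis
      proof eventually_elim
        case (elim n)
        define \<epsilon> where "\<epsilon> = D / Suc n"
        have lt: "2 * \<epsilon> < min \<rho> 1"
          using elim by (simp only: \<epsilon>_def divide_inverse)
        then have \<epsilon>: "0 < \<epsilon>" "\<epsilon> \<le> D" "2 * \<epsilon> \<le> \<rho>" "2 * \<epsilon> \<le> 1"
          using D_pos by (simp_all add: \<epsilon>_def[symmetric]) (simp_all add: \<epsilon>_def field_simps)
        obtain S where S: "finite S" "S \<subseteq> F" "pairwise (\<lambda>s t. \<epsilon> \<le> d s t) S" "F \<subseteq> (\<Union>s\<in>S. mball s \<epsilon>)"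
          using finite_net[OF sub \<epsilon>(1,2)] by metis
        have card: "card S * (c * (\<epsilon> / 2) powr \<delta>) \<le> measure \<mu> (?V n)"
        proof (rule card_separated_le)
          fix s assume "s \<in> S"
          then show "mball s (\<epsilon> / 2) \<subseteq> ?V n"
            using S(2) mball_subset_concentric[of "\<epsilon> / 2" \<epsilon> s] \<epsilon>(1)
            unfolding \<epsilon>_def[symmetric] by (intro order_trans[OF _ UN_upper[of s]]) auto
        qed (use S sub \<epsilon> in \<open>auto intro!: openin_sets openin_Union\<close>)
        have "f (2 * \<epsilon>) \<le> A * (2 * \<epsilon>) powr \<delta>"
          using \<epsilon> by (intro A) auto
        also have "(2 * \<epsilon>) powr \<delta> = (4 * (\<epsilon> / 2)) powr \<delta>" by simp
        also have "\<dots> = 4 powr \<delta> * (\<epsilon> / 2) powr \<delta>"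
          using \<epsilon> by (intro powr_mult)
        finally have "f (2 * \<epsilon>) \<le> K * (c * (\<epsilon> / 2) powr \<delta>)"
          using c_pos by (simp add: K_def)
        then have "card S * f (2 * \<epsilon>) \<le> card S * (K * (c * (\<epsilon> / 2) powr \<delta>))"
          by (intro mult_left_mono) auto
        also have "\<dots> = K * (card S * (c * (\<epsilon> / 2) powr \<delta>))" by simp
        also have "\<dots> \<le> K * measure \<mu> (?V n)"
          using A0 c_pos by (intro mult_left_mono card) (simp add: K_def)
        finally show ?case
          using hausdorff_premeasure_le_card[OF f S(1,4) \<epsilon>(1,3)] by (auto intro: order_trans ennreal_leI)
      qed
    qed
    ultimately have "hausdorff_premeasure M d f \<rho> F \<le> ennreal (K * measure \<mu> F)"
      by (intro tendsto_lowerbound) auto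
    then show ?thesis using F by simp
  qed
  then show ?thesis unfolding hausdorff_measure_def by auto
qed

text \<open>
  Disjoint balls \<open>mball (x i) (K * r i)\<close> fill a fixed proportion of each neighbourhood of \<open>F\<close>, and
  the balls \<open>mball (z i) (r i)\<close> in them a fixed proportion again; as these miss \<open>F\<close>, letting the
  neighbourhoods shrink to \<open>F\<close> forces \<open>\<mu>(F) \<le> (1 - q) \<mu>(F)\<close>.
\<close>

lemma measure_closed_avoiding_balls:
  fixes x z :: "nat \<Rightarrow> 'a" and r :: "nat \<Rightarrow> real"
  assumes x: "\<And>i. x i \<in> M" "\<And>i. z i \<in> M" and r: "\<And>i. 0 < r i" "r \<longlonglongrightarrow> 0" and K: "0 < K"
    and sub: "\<And>i. m \<le> i \<Longrightarrow> mball (z i) (r i) \<subseteq> mball (x i) (K * r i)"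
    and full: "M - limsup (\<lambda>i. mball (x i) (K * r i)) \<in> null_sets \<mu>"
    and F: "closedin mtopology F" "\<And>i. m \<le> i \<Longrightarrow> F \<inter> mball (z i) (r i) = {}"
  shows "measure \<mu> F = 0"
proof -
  let ?V = "\<lambda>n. \<Union>q\<in>F. mball q (D / Suc n)"
  \<comment> \<open>The volume bound \<open>c * r i powr \<delta>\<close> of a shifted ball, divided
    by \<open>2 * C * 3 powr \<delta> * (K * r i) powr \<delta>\<close>, its share in the bound of
    \<open>disjoint_balls_in_open\<close> with \<open>L = 1\<close>.\<close>
  define q where "q = c / (2 * C * (3 * K) powr \<delta>)"
  have q: "0 < q" using c_pos C_pos K by (simp add: q_def)
  have FM: "F \<subseteq> M" using closedin_subset[OF F(1)] by simp
  have F_sets [measurable]: "F \<in> sets \<mu>"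
  proof -
    have "M - F \<in> sets \<mu>" "M \<in> sets \<mu>"
      using F(1) by (auto intro!: openin_sets simp: closedin_def)
    then have "M - (M - F) \<in> sets \<mu>" by blast
    also have "M - (M - F) = F" using FM by blast
    finally show ?thesis .
  qed
  have "\<forall>\<^sub>F i in sequentially. r i < D" using order_tendstoD(2)[OF r(2) D_pos] .
  then obtain k where k: "\<And>i. k \<le> i \<Longrightarrow> r i < D" unfolding eventually_sequentially by blast
  have le: "measure \<mu> F + q * measure \<mu> (?V n) \<le> measure \<mu> (?V n)" for n
  proof -
    have V: "openin mtopology (?V n)" by (intro openin_Union) auto
    then have [measurable]: "?V n \<in> sets \<mu>" by (rule openin_sets)
    have lim: "(\<lambda>i. K * r i) \<longlonglongrightarrow> 0" using tendsto_mult_right_zero[OF r(2)] .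
    have K_r: "0 < K * r i" for i using K r(1) by simp
    have fullV: "?V n - limsup (\<lambda>i. mball (x i) (K * r i)) \<in> null_sets \<mu>"
    proof (rule null_sets_subset[OF full])
      show "?V n - limsup (\<lambda>i. mball (x i) (K * r i)) \<in> sets \<mu>"
        unfolding limsup_INF_SUP by measurable
    qed auto
    obtain J where J: "finite J" "\<And>i. i \<in> J \<Longrightarrow> max m k \<le> i"
        "\<And>i. i \<in> J \<Longrightarrow> mball (x i) (1 * (K * r i)) \<subseteq> ?V n"
        "disjoint_family_on (\<lambda>i. mball (x i) (1 * (K * r i))) J"
        "measure \<mu> (?V n) \<le> 2 * C * (3 * 1) powr \<delta> * (\<Sum>i\<in>J. (K * r i) powr \<delta>)"
      by (rule disjoint_balls_in_open[OF V x(1) K_r lim order_refl fullV, where m = "max m k"]) (rule that)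
    have subJ: "mball (z i) (r i) \<subseteq> mball (x i) (1 * (K * r i))" if "i \<in> J" for i
      using sub J(2)[OF that] by simp
    have disj: "disjoint_family_on (\<lambda>i. mball (z i) (r i)) J"
      using J(4) subJ unfolding disjoint_family_on_def by (meson disjoint_iff subsetD)
    have "(\<Sum>i\<in>J. c * r i powr \<delta>) \<le> (\<Sum>i\<in>J. measure \<mu> (mball (z i) (r i)))"
      using J(2) k r(1) x by (intro sum_mono lower) (auto intro: less_imp_le)
    also have "\<dots> = measure \<mu> (\<Union>i\<in>J. mball (z i) (r i))"
      using J(1) disj by (intro finite_measure_finite_Union[symmetric]) auto
    finally have 1: "(\<Sum>i\<in>J. c * r i powr \<delta>) \<le> measure \<mu> (\<Union>i\<in>J. mball (z i) (r i))" .
    have "q * measure \<mu> (?V n) \<le> q * (2 * C * (3 * 1) powr \<delta> * (\<Sum>i\<in>J. (K * r i) powr \<delta>))"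
      using J(5) q by (intro mult_left_mono) auto
    also have "\<dots> = (\<Sum>i\<in>J. c * r i powr \<delta>)"
      using K r(1) C_pos by (simp add: q_def powr_mult less_imp_le sum_distrib_left[symmetric] field_simps)
    finally have 2: "q * measure \<mu> (?V n) \<le> measure \<mu> (\<Union>i\<in>J. mball (z i) (r i))" using 1 by simp
    have FV: "F \<subseteq> ?V n" using FM D_pos by force
    have "F \<inter> mball (z i) (r i) = {}" if "i \<in> J" for i
      using F(2)[of i] J(2)[OF that] by simp
    then have "F \<inter> (\<Union>i\<in>J. mball (z i) (r i)) = {}" by blast
    then have "measure \<mu> F + measure \<mu> (\<Union>i\<in>J. mball (z i) (r i)) = measure \<mu> (F \<union> (\<Union>i\<in>J. mball (z i) (r i)))"
      using J(1) by (intro finite_measure_Union[symmetric] sets.finite_UN) auto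
    also have "\<dots> \<le> measure \<mu> (?V n)"
    proof (intro finite_measure_mono Un_least UN_least FV openin_sets[OF V])
      show "mball (z i) (r i) \<subseteq> ?V n" if "i \<in> J" for i
        using order_trans[OF subJ[OF that] J(3)[OF that]] .
    qed
    finally show ?thesis using 2 by simp
  qed
  note lim = measure_neighbourhoods[OF F(1)]
  have "measure \<mu> F + q * measure \<mu> F \<le> measure \<mu> F"
  proof (rule LIMSEQ_le[OF _ lim])
    show "(\<lambda>n. measure \<mu> F + q * measure \<mu> (?V n)) \<longlonglongrightarrow> measure \<mu> F + q * measure \<mu> F"
      by (intro tendsto_intros lim)
    show "\<exists>N. \<forall>n\<ge>N. measure \<mu> F + q * measure \<mu> (?V n) \<le> measure \<mu> (?V n)"
      using le by blast
  qed
  then show ?thesis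
    using q measure_nonneg[of \<mu> F] by (simp add: mult_le_0_iff)
qed

text \<open>A point outside the limsup set misses all balls of large index. The points missing all
  open balls from some index on form a closed set, so the complement is a countable union of closed
  sets of measure zero.\<close>

lemma hausdorff_measure_limsup_comparable:
  fixes x z :: "nat \<Rightarrow> 'a" and r :: "nat \<Rightarrow> real"
  assumes x: "\<And>i. x i \<in> M" "\<And>i. z i \<in> M" and r: "\<And>i. 0 < r i" "r \<longlonglongrightarrow> 0" and K: "0 < K"
    and sub: "\<And>i. m \<le> i \<Longrightarrow> mball (z i) (r i) \<subseteq> mball (x i) (K * r i)"
    and full: "M - limsup (\<lambda>i. mball (x i) (K * r i)) \<in> null_sets \<mu>"
    and f: "mono_on {0<..} f" "\<And>t. 0 < t \<Longrightarrow> 0 \<le> f t"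
    and A: "\<And>t. \<lbrakk>0 < t; t \<le> 1\<rbrakk> \<Longrightarrow> f t \<le> A * t powr \<delta>"
  shows "hausdorff_measure M d f (mball y s \<inter> limsup (\<lambda>i. mball (z i) (r i))) =
         hausdorff_measure M d f (mball y s)"
proof -
  \<comment> \<open>Closed balls of radii increasing to \<open>s\<close> exhaust the open ball
    \<open>mball y s\<close> and keep \<open>N n\<close> closed.\<close>
  define N where "N n = mcball y (s - 1 / Suc n) - (\<Union>i\<in>{max m n..}. mball (z i) (r i))" for n
  have N: "closedin mtopology (N n)" for n
    unfolding N_def by (intro closedin_diff openin_Union) auto
  have "measure \<mu> (N n) = 0" for n
    by (rule measure_closed_avoiding_balls[OF x r K _ full N, of "max m n"])
      (use sub in \<open>auto simp: N_def\<close>)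
  then have "hausdorff_measure M d f (N n) = 0" for n
    using hausdorff_measure_closed_null[OF N _ f A] by blast
  moreover have "mball y s \<subseteq> mball y s \<inter> limsup (\<lambda>i. mball (z i) (r i)) \<union> (\<Union>n. N n)"
  proof
    fix p assume p: "p \<in> mball y s"
    show "p \<in> mball y s \<inter> limsup (\<lambda>i. mball (z i) (r i)) \<union> (\<Union>n. N n)"
    proof (cases "p \<in> limsup (\<lambda>i. mball (z i) (r i))")
      case False
      then obtain k where k: "\<And>i. k \<le> i \<Longrightarrow> p \<notin> mball (z i) (r i)"
        unfolding limsup_INF_SUP by auto
      have "0 < s - d y p" using p by auto
      then obtain l where l: "inverse (real (Suc l)) < s - d y p"
        using reals_Archimedean by blast
      have "inverse (real (Suc (max k l))) \<le> inverse (real (Suc l))"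
        by (intro le_imp_inverse_le) auto
      then have "p \<in> N (max k l)"
        using p k l by (auto simp: N_def inverse_eq_divide)
      then show ?thesis by blast
    qed (use p in blast)
  qed
  ultimately show ?thesis
    by (intro hausdorff_measure_eq_of_null_cover) auto
qed

end

section \<open>Layered families of shifted balls\<close>

text \<open>Either one term reaches \<open>k\<close>, and its truncation is \<open>k\<close>, or no
  term is truncated. An overloaded ball thus stays overloaded when each set is charged at most the
  threshold.\<close>

lemma le_sum_min:
  fixes a :: "'i \<Rightarrow> real"
  assumes "finite S" "\<And>j. j \<in> S \<Longrightarrow> 0 \<le> a j" "0 \<le> k" "k \<le> (\<Sum>j\<in>S. a j)"
  shows "k \<le> (\<Sum>j\<in>S. min (a j) k)"
proof (cases "\<exists>j\<in>S. k \<le> a j")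
  case True
  then obtain j where j: "j \<in> S" "k \<le> a j" by blast
  have "k = min (a j) k" using j by simp
  also have "\<dots> \<le> (\<Sum>j\<in>S. min (a j) k)"
    using assms(1-3) j(1) by (intro member_le_sum) auto
  finally show ?thesis .
next
  case False
  then have "(\<Sum>j\<in>S. min (a j) k) = (\<Sum>j\<in>S. a j)" by (intro sum.cong) auto
  then show ?thesis using assms(4) by simp
qed

lemma sum_le_single:
  fixes g :: "'i \<Rightarrow> real"
  assumes "\<And>i k. \<lbrakk>i \<in> S; k \<in> S\<rbrakk> \<Longrightarrow> i = k" "\<And>i. i \<in> S \<Longrightarrow> g i \<le> a" "0 \<le> a"
  shows "sum g S \<le> a"
proof (cases "S = {}")
  case False
  then obtain i where "S = {i}" using assms(1) by blast
  then show ?thesis using assms(2) by simp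
qed (use assms(3) in simp)

text \<open>Here \<open>b i\<close> stands for \<open>f (r i) powr (1 / \<delta>)\<close>. The
  dimension function itself stays outside: the combinatorial part sees it only through
  \<open>b\<close> and the costs \<open>a\<close> of the covering sets.\<close>

locale shifted_balls = regular_metric_measure +
  fixes x z :: "nat \<Rightarrow> 'a" and r b :: "nat \<Rightarrow> real" and C0 :: real
  assumes centres: "x i \<in> M" "z i \<in> M"
    and radii_pos: "0 < r i" "0 < b i"
    and b_tendsto: "b \<longlonglongrightarrow> 0"
    and ratio_tendsto: "(\<lambda>i. r i / b i) \<longlonglongrightarrow> 0"
    and C0_nonneg: "0 \<le> C0"
    and shift_le: "d (x i) (z i) \<le> C0 * b i"
    and full: "M - limsup (\<lambda>i. mball (x i) (b i)) \<in> null_sets \<mu>"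
begin

text \<open>The radius has room for the shift \<open>C0 * b i\<close> and for the ball of radius
  \<open>2 * b i\<close> about \<open>z i\<close>; disjointness of the sets \<open>W i\<close> hence
  separates the sets \<open>Z i\<close>.\<close>

definition W :: "nat \<Rightarrow> 'a set" where "W i = mball (x i) ((C0 + 3) * b i)"
definition Z :: "nat \<Rightarrow> 'a set" where "Z i = mball (z i) (r i)"
text \<open>If a set of diameter \<open>t\<close> meets \<open>Z i\<close> and
  \<open>r i \<le> b i \<le> t\<close>, then \<open>W i\<close> lies within
  \<open>(2 * C0 + 5) * t\<close> of any of its points; \<open>Q\<close> compares the volume of that
  ball with the lower bound for the balls of radius \<open>b i\<close>.\<close>

definition Q :: real where "Q = C / c * (2 * C0 + 5) powr \<delta>"
text \<open>From the bottom up: half of the volume \<open>c * (R / 2) powr \<delta>\<close> is still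
  free for a layer, and \<open>disjoint_balls_in_open\<close> with \<open>L = C0 + 3\<close> turns
  free volume into weight.\<close>

definition q :: real where "q = c / (2 * (2 * C * (3 * (C0 + 3)) powr \<delta>) * 2 powr \<delta>)"

lemma Q_pos: "0 < Q" and q_pos: "0 < q"
  using c_pos C_pos C0_nonneg by (auto simp: Q_def q_def)

lemma mball_subset_W: "mball (z i) (2 * b i) \<subseteq> W i"
  unfolding W_def using centres shift_le[of i] radii_pos(2)[of i] commute[of "x i" "z i"]
  by (intro mball_subset) (auto simp: algebra_simps)

lemma Z_subset_W:
  assumes "r i \<le> b i"
  shows "Z i \<subseteq> W i"
  unfolding Z_def using assms radii_pos(2)[of i]
  by (intro order_trans[OF mball_subset_concentric mball_subset_W]) auto

text \<open>The last clause makes the volume of \<open>Z i\<close> negligible against the weight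
  \<open>b i powr \<delta>\<close>; this leaves room for further layers.\<close>

lemma eventually_small:
  assumes "0 < \<epsilon>" "0 < \<eta>"
  shows "\<forall>\<^sub>F i in sequentially. r i \<le> b i \<and> b i \<le> \<epsilon> \<and> (r i / b i) powr \<delta> \<le> \<eta>"
proof -
  have "\<forall>\<^sub>F i in sequentially. r i / b i < 1" "\<forall>\<^sub>F i in sequentially. b i < \<epsilon>"
    using order_tendstoD(2)[OF ratio_tendsto, of 1] order_tendstoD(2)[OF b_tendsto assms(1)] by auto
  moreover have "\<forall>\<^sub>F i in sequentially. r i / b i < \<eta> powr (1 / \<delta>)"
    using order_tendstoD(2)[OF ratio_tendsto, of "\<eta> powr (1 / \<delta>)"] assms by auto
  ultimately show ?thesis
  proof eventually_elim
    case (elim i)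
    have "(r i / b i) powr \<delta> \<le> (\<eta> powr (1 / \<delta>)) powr \<delta>"
      using elim(3) radii_pos \<delta>_pos by (intro powr_mono2) (auto simp: less_imp_le)
    also have "\<dots> = \<eta>" using assms \<delta>_pos by (simp add: powr_powr)
    finally show ?case using elim radii_pos(2)[of i] by (simp add: divide_less_eq)
  qed
qed

lemma W_sets: "W i \<in> sets \<mu>"
  by (simp add: W_def)

lemma sum_le_measure_Union:
  assumes J: "finite J" "disjoint_family_on W J" and small: "\<And>i. i \<in> J \<Longrightarrow> b i \<le> D"
  shows "c * (\<Sum>i\<in>J. b i powr \<delta>) \<le> measure \<mu> (\<Union>i\<in>J. W i)"
proof -
  have "c * (\<Sum>i\<in>J. b i powr \<delta>) \<le> (\<Sum>i\<in>J. measure \<mu> (W i))"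
    unfolding sum_distrib_left
  proof (rule sum_mono)
    fix i assume i: "i \<in> J"
    have "c * b i powr \<delta> \<le> measure \<mu> (mball (x i) (b i))"
      using centres radii_pos small[OF i] by (intro lower) auto
    also have "\<dots> \<le> measure \<mu> (W i)"
      unfolding W_def using C0_nonneg radii_pos(2)[of i]
      by (intro finite_measure_mono mball_subset_concentric mball_sets) auto
    finally show "c * b i powr \<delta> \<le> measure \<mu> (W i)" .
  qed
  also have "\<dots> = measure \<mu> (\<Union>i\<in>J. W i)"
    using J by (intro finite_measure_finite_Union[symmetric]) (auto simp: W_sets)
  finally show ?thesis .
qed

text \<open>For \<open>p\<close> in \<open>U\<close>, the distance from \<open>x i\<close> to
  \<open>p\<close> is at most \<open>C0 * t + t + t\<close>: the shift, the radius of
  \<open>Z i\<close> and the diameter of \<open>U\<close>. Adding the radius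
  \<open>(C0 + 3) * b i\<close> puts every \<open>W i\<close> into one ball of radius
  \<open>(2 * C0 + 5) * t\<close>, where the disjoint sets compete for volume.\<close>

lemma sum_large_hits_le:
  assumes J: "finite J" "disjoint_family_on W J"
    and small: "\<And>i. i \<in> J \<Longrightarrow> r i \<le> b i \<and> b i \<le> D \<and> b i \<le> t"
    and hit: "\<And>i. i \<in> J \<Longrightarrow> U \<inter> Z i \<noteq> {}"
    and diam: "\<And>p q. \<lbrakk>p \<in> U; q \<in> U\<rbrakk> \<Longrightarrow> d p q \<le> t"
  shows "(\<Sum>i\<in>J. b i powr \<delta>) \<le> Q * t powr \<delta>"
proof (cases "J = {}")
  case True
  then show ?thesis using Q_pos by simp
next
  case False
  then obtain i0 where i0: "i0 \<in> J" by blast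
  then obtain p where p: "p \<in> U" "p \<in> M" using hit[of i0] by (auto simp: Z_def)
  have t: "0 < t" using small[OF i0] radii_pos(2)[of i0] by linarith
  have W_sub: "W i \<subseteq> mball p ((2 * C0 + 5) * t)" if i: "i \<in> J" for i
  proof -
    obtain u where u: "u \<in> U" "u \<in> Z i" using hit[OF i] by blast
    have uM: "u \<in> M" "d (z i) u < b i" using u small[OF i] by (auto simp: Z_def)
    have "d (x i) p \<le> d (x i) u + d u p" "d (x i) u \<le> d (x i) (z i) + d (z i) u"
      using p uM centres by (auto intro!: triangle)
    then have "d (x i) p \<le> C0 * b i + b i + t"
      using shift_le[of i] uM diam[OF u(1) p(1)] by linarith
    moreover have "C0 * b i \<le> C0 * t" using small[OF i] C0_nonneg by (intro mult_left_mono) auto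
    ultimately have "d (x i) p + (C0 + 3) * b i \<le> (2 * C0 + 5) * t"
      using small[OF i] by (simp add: algebra_simps)
    then show ?thesis unfolding W_def using p by (intro mball_subset) auto
  qed
  have "c * (\<Sum>i\<in>J. b i powr \<delta>) \<le> measure \<mu> (\<Union>i\<in>J. W i)"
    using J small by (intro sum_le_measure_Union) auto
  also have "\<dots> \<le> measure \<mu> (mball p ((2 * C0 + 5) * t))"
    using W_sub by (intro finite_measure_mono mball_sets UN_least)
  also have "\<dots> \<le> C * ((2 * C0 + 5) * t) powr \<delta>"
    using p t C0_nonneg by (intro upper) auto
  also have "\<dots> = c * (Q * t powr \<delta>)"
    using c_pos C0_nonneg t by (simp add: Q_def powr_mult)
  finally show ?thesis using c_pos by simp
qed

text \<open>This crude bound holds for a layer not yet chosen, so the smallness required of its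
  balls can be fixed in advance.\<close>

lemma sum_disjoint_le:
  assumes J: "finite J" "disjoint_family_on W J" and small: "\<And>i. i \<in> J \<Longrightarrow> b i \<le> D"
  shows "(\<Sum>i\<in>J. b i powr \<delta>) \<le> measure \<mu> (space \<mu>) / c"
proof -
  have "c * (\<Sum>i\<in>J. b i powr \<delta>) \<le> measure \<mu> (\<Union>i\<in>J. W i)"
    using J small by (intro sum_le_measure_Union) auto
  also have "\<dots> \<le> measure \<mu> (space \<mu>)" by (rule bounded_measure)
  finally show ?thesis using c_pos by (simp add: field_simps)
qed

text \<open>
  A union of \<open>l\<close> layers of small balls inside \<open>mball z0 R\<close>. Each layer has weight
  \<open>\<Sum> b\<^sub>i\<^sup>\<delta>\<close> at least \<open>q R\<^sup>\<delta>\<close>, whereas a set of diameter \<open>t\<close> meets balls with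
  \<open>b\<^sub>i \<le> t\<close> of weight at most \<open>Q t\<^sup>\<delta>\<close> per layer. The separation makes it meet at most one ball
  with \<open>b\<^sub>i > t\<close> in all layers together. The last clause keeps half of the volume free for the
  next layer, which must avoid the balls of the previous ones.
\<close>

definition layered :: "'a \<Rightarrow> real \<Rightarrow> nat \<Rightarrow> nat \<Rightarrow> nat set \<Rightarrow> bool" where
  "layered z0 R m l J \<longleftrightarrow> finite J \<and>
     (\<forall>i\<in>J. m \<le> i \<and> r i \<le> b i \<and> b i \<le> D \<and> W i \<subseteq> mball z0 (R / 2)) \<and>
     (\<forall>i\<in>J. \<forall>k\<in>J. i \<noteq> k \<longrightarrow> (\<forall>p\<in>Z i. \<forall>u\<in>Z k. min (b i) (b k) \<le> d p u)) \<and>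
     (\<forall>U t. (\<forall>p\<in>U. \<forall>u\<in>U. d p u \<le> t) \<longrightarrow>
        (\<Sum>i\<in>{i \<in> J. U \<inter> Z i \<noteq> {} \<and> b i \<le> t}. b i powr \<delta>) \<le> l * Q * t powr \<delta>) \<and>
     l * q * R powr \<delta> \<le> (\<Sum>i\<in>J. b i powr \<delta>) \<and>
     (\<Sum>i\<in>J. measure \<mu> (mball (z i) (3 * r i))) < measure \<mu> (mball z0 (R / 2)) / 2"

text \<open>The new layer is taken from the part of the ball away from the old shifted balls, which
  still has half of the volume, and its indices are so large that its balls are tiny compared with
  the old radii and with the remaining volume.\<close>

lemma layered_Suc:
  assumes z0: "z0 \<in> M" "0 < R" "R \<le> D" and J: "layered z0 R m l J"
  shows "\<exists>J. layered z0 R m (Suc l) J"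
proof -
  define B where "B = mball z0 (R / 2)"
  \<comment> \<open>The slack in the volume clause of \<open>layered\<close>; the new shifted balls,
    tripled, have to use up less than \<open>s\<close>.\<close>
  define s where "s = measure \<mu> B / 2 - (\<Sum>i\<in>J. measure \<mu> (mball (z i) (3 * r i)))"
  have s: "0 < s" using J by (simp add: layered_def s_def B_def)
  have fin: "finite J" using J by (simp add: layered_def)
  \<comment> \<open>Closed balls keep \<open>V\<close> open, and the radius \<open>2 * r i\<close>
    keeps \<open>V\<close> at distance more than \<open>r i\<close> from the points of
    \<open>Z i\<close>.\<close>
  define V where "V = B - (\<Union>i\<in>J. mcball (z i) (2 * r i))"
  have V: "openin mtopology V"
    unfolding V_def B_def using fin by (intro openin_diff closedin_Union) auto
  have VB: "V \<subseteq> B" by (auto simp: V_def)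
  \<comment> \<open>New balls have \<open>b k \<le> \<epsilon> \<le> r i\<close> for every old
    \<open>i\<close>, which gives the separation of old from new. The entry \<open>D\<close> covers
    the case of an empty \<open>J\<close>.\<close>
  define \<epsilon> where "\<epsilon> = Min (insert D (r ` J))"
  have \<epsilon>: "0 < \<epsilon>" "\<epsilon> \<le> D" "\<And>i. i \<in> J \<Longrightarrow> \<epsilon> \<le> r i"
    using fin D_pos radii_pos by (auto simp: \<epsilon>_def)
  \<comment> \<open>With \<open>(r i / b i) powr \<delta> \<le> s / T\<close>, the tripled balls of
    any admissible layer have total volume below \<open>s\<close>; the summand 1 makes this
    strict.\<close>
  define T where "T = C * 3 powr \<delta> * (measure \<mu> (space \<mu>) / c + 1)"
  have T: "0 < T" unfolding T_def using C_pos c_pos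
    by (intro mult_pos_pos add_nonneg_pos divide_nonneg_pos) auto
  obtain m' where m': "\<And>i. m' \<le> i \<Longrightarrow> r i \<le> b i \<and> b i \<le> \<epsilon> \<and> (r i / b i) powr \<delta> \<le> s / T"
    using eventually_small[OF \<epsilon>(1), of "s / T"] s T unfolding eventually_sequentially by auto
  have fullV: "V - limsup (\<lambda>i. mball (x i) (b i)) \<in> null_sets \<mu>"
  proof (rule null_sets_subset[OF full])
    have [measurable]: "V \<in> sets \<mu>" using V by (rule openin_sets)
    show "V - limsup (\<lambda>i. mball (x i) (b i)) \<in> sets \<mu>"
      unfolding limsup_INF_SUP by measurable
  qed (auto simp: V_def B_def)
  obtain J' where J': "finite J'" "\<And>i. i \<in> J' \<Longrightarrow> max m m' \<le> i"
      "\<And>i. i \<in> J' \<Longrightarrow> mball (x i) ((C0 + 3) * b i) \<subseteq> V"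
      "disjoint_family_on (\<lambda>i. mball (x i) ((C0 + 3) * b i)) J'"
      "measure \<mu> V \<le> 2 * C * (3 * (C0 + 3)) powr \<delta> * (\<Sum>i\<in>J'. b i powr \<delta>)"
    by (rule disjoint_balls_in_open[OF V centres(1) radii_pos(2) b_tendsto _ fullV,
          where m = "max m m'" and L = "C0 + 3"]) (use C0_nonneg in simp, rule that)
  have W: "W i \<subseteq> V" if "i \<in> J'" for i using J'(3)[OF that] by (simp add: W_def)
  have disj: "disjoint_family_on W J'" using J'(4) by (simp add: W_def[abs_def])
  have J'_small: "m \<le> i" "r i \<le> b i" "b i \<le> \<epsilon>" "b i \<le> D" "(r i / b i) powr \<delta> \<le> s / T" if "i \<in> J'" for i
    using J'(2)[OF that] m'[of i] \<epsilon>(2) by auto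
  have sep: "min (b i) (b k) \<le> d p u" if i: "i \<in> J" and k: "k \<in> J'" and pu: "p \<in> Z i" "u \<in> Z k" for i k p u
  proof -
    have "u \<in> V" using pu(2) Z_subset_W[OF J'_small(2)[OF k]] W[OF k] by blast
    then have "2 * r i < d (z i) u" using i centres by (auto simp: V_def B_def)
    moreover have "d (z i) u \<le> d (z i) p + d p u" using pu centres by (intro triangle) (auto simp: Z_def)
    moreover have "d (z i) p < r i" using pu by (simp add: Z_def)
    ultimately show ?thesis using \<epsilon>(3)[OF i] J'_small(3)[OF k] by linarith
  qed
  have sep': "min (b i) (b k) \<le> d p u" if ik: "i \<in> J'" "k \<in> J'" "i \<noteq> k" and pu: "p \<in> Z i" "u \<in> Z k" for i k p u
  proof -
    have "u \<in> W k" using pu(2) Z_subset_W[OF J'_small(2)[OF ik(2)]] by blast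
    then have "u \<notin> mball (z i) (2 * b i)"
      using mball_subset_W[of i] disj ik unfolding disjoint_family_on_def by blast
    then have "2 * b i \<le> d (z i) u" using pu by (auto simp: Z_def)
    moreover have "d (z i) u \<le> d (z i) p + d p u" using pu centres by (intro triangle) (auto simp: Z_def)
    moreover have "d (z i) p < r i" using pu by (simp add: Z_def)
    ultimately show ?thesis using J'_small(2)[OF ik(1)] by linarith
  qed
  \<comment> \<open>A common index would make \<open>z i\<close> lie at distance at least
    \<open>b i\<close> from itself.\<close>
  have dJ: "J \<inter> J' = {}"
  proof (rule ccontr)
    assume "J \<inter> J' \<noteq> {}"
    then obtain i where i: "i \<in> J" "i \<in> J'" by blast
    have "z i \<in> Z i" using centres radii_pos by (simp add: Z_def)
    from sep[OF i this this] show False using radii_pos(2)[of i] centres by simp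
  qed
  have "(\<Sum>i\<in>J'. measure \<mu> (mball (z i) (3 * r i))) \<le> (\<Sum>i\<in>J'. C * 3 powr \<delta> * (s / T) * b i powr \<delta>)"
  proof (rule sum_mono)
    fix i assume i: "i \<in> J'"
    have "measure \<mu> (mball (z i) (3 * r i)) \<le> C * (3 * r i) powr \<delta>"
      using centres radii_pos by (intro upper) auto
    also have "(3 * r i) powr \<delta> = 3 powr \<delta> * (r i / b i) powr \<delta> * b i powr \<delta>"
      using radii_pos[of i] by (simp add: powr_mult powr_divide)
    also have "C * \<dots> \<le> C * (3 powr \<delta> * (s / T) * b i powr \<delta>)"
      using C_pos J'_small(5)[OF i] by (intro mult_left_mono mult_right_mono) auto
    finally show "measure \<mu> (mball (z i) (3 * r i)) \<le> C * 3 powr \<delta> * (s / T) * b i powr \<delta>"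
      by (simp add: mult.assoc)
  qed
  also have "\<dots> = C * 3 powr \<delta> * (s / T) * (\<Sum>i\<in>J'. b i powr \<delta>)"
    by (simp add: sum_distrib_left)
  also have "\<dots> < C * 3 powr \<delta> * (s / T) * (measure \<mu> (space \<mu>) / c + 1)"
    using sum_disjoint_le[OF J'(1) disj] J'_small(4) C_pos s T
    by (intro mult_strict_left_mono mult_pos_pos) (auto intro: le_less_trans)
  also have "\<dots> = s"
  proof -
    have "C * 3 powr \<delta> * (s / T) * (measure \<mu> (space \<mu>) / c + 1) = s / T * T"
      unfolding T_def by (simp only: ac_simps)
    then show ?thesis using T by simp
  qed
  finally have 3: "(\<Sum>i\<in>J'. measure \<mu> (mball (z i) (3 * r i))) < s" .
  \<comment> \<open>The removed closed balls of radius \<open>2 * r i\<close> are enlarged to open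
    balls of radius \<open>3 * r i\<close>, the ones that the volume clause of
    \<open>layered\<close> controls.\<close>
  have "measure \<mu> B \<le> measure \<mu> (V \<union> (\<Union>i\<in>J. mball (z i) (3 * r i)))"
  proof (intro finite_measure_mono sets.Un sets.finite_UN openin_sets[OF V] fin mball_sets)
    have "mcball (z i) (2 * r i) \<subseteq> mball (z i) (3 * r i)" for i
      using radii_pos(1)[of i] by (intro mcball_subset_mball_concentric) auto
    then show "B \<subseteq> V \<union> (\<Union>i\<in>J. mball (z i) (3 * r i))" unfolding V_def by blast
  qed
  also have "\<dots> \<le> measure \<mu> V + measure \<mu> (\<Union>i\<in>J. mball (z i) (3 * r i))"
    using fin by (intro measure_Un_le openin_sets[OF V] sets.finite_UN mball_sets)
  also have "measure \<mu> (\<Union>i\<in>J. mball (z i) (3 * r i)) \<le> (\<Sum>i\<in>J. measure \<mu> (mball (z i) (3 * r i)))"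
    using fin by (intro finite_measure_subadditive_finite) auto
  finally have "measure \<mu> B / 2 \<le> measure \<mu> V" using s by (simp add: s_def)
  moreover have "c * (R / 2) powr \<delta> \<le> measure \<mu> B"
    unfolding B_def using z0 by (intro lower) auto
  ultimately have "c * (R / 2) powr \<delta> / 2 \<le> 2 * C * (3 * (C0 + 3)) powr \<delta> * (\<Sum>i\<in>J'. b i powr \<delta>)"
    using J'(5) by linarith
  then have 1: "q * R powr \<delta> \<le> (\<Sum>i\<in>J'. b i powr \<delta>)"
    using C_pos C0_nonneg z0 by (simp add: q_def powr_divide field_simps)
  have 2: "(\<Sum>i\<in>{i \<in> J \<union> J'. U \<inter> Z i \<noteq> {} \<and> b i \<le> t}. b i powr \<delta>) \<le> Suc l * Q * t powr \<delta>"
    if diam: "\<forall>p\<in>U. \<forall>u\<in>U. d p u \<le> t" for U t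
  proof -
    let ?H = "\<lambda>J. {i \<in> J. U \<inter> Z i \<noteq> {} \<and> b i \<le> t}"
    have "?H (J \<union> J') = ?H J \<union> ?H J'" by blast
    then have "(\<Sum>i\<in>?H (J \<union> J'). b i powr \<delta>) = (\<Sum>i\<in>?H J. b i powr \<delta>) + (\<Sum>i\<in>?H J'. b i powr \<delta>)"
      using fin J'(1) dJ by (simp only:) (intro sum.union_disjoint; auto)
    moreover have "(\<Sum>i\<in>?H J. b i powr \<delta>) \<le> l * Q * t powr \<delta>"
      using J diam unfolding layered_def by blast
    moreover have "(\<Sum>i\<in>?H J'. b i powr \<delta>) \<le> Q * t powr \<delta>"
    proof (rule sum_large_hits_le[where U = U])
      show "disjoint_family_on W (?H J')"
        by (rule disjoint_family_on_mono[OF _ disj]) auto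
    qed (use J'(1) J'_small diam in auto)
    ultimately show ?thesis by (simp add: algebra_simps)
  qed
  have "layered z0 R m (Suc l) (J \<union> J')"
    unfolding layered_def
  proof (intro conjI)
    show "finite (J \<union> J')" using fin J'(1) by simp
    show "\<forall>i\<in>J \<union> J'. m \<le> i \<and> r i \<le> b i \<and> b i \<le> D \<and> W i \<subseteq> mball z0 (R / 2)"
    proof (intro ballI)
      fix i assume "i \<in> J \<union> J'"
      then show "m \<le> i \<and> r i \<le> b i \<and> b i \<le> D \<and> W i \<subseteq> mball z0 (R / 2)"
      proof
        assume "i \<in> J'"
        then show ?thesis
          using J'_small[of i] order_trans[OF W[of i] VB] by (simp add: B_def)
      qed (use J in \<open>simp add: layered_def\<close>)
    qed
    show "\<forall>i\<in>J \<union> J'. \<forall>k\<in>J \<union> J'. i \<noteq> k \<longrightarrow> (\<forall>p\<in>Z i. \<forall>u\<in>Z k. min (b i) (b k) \<le> d p u)"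
    proof (intro ballI impI)
      fix i k p u assume *: "i \<in> J \<union> J'" "k \<in> J \<union> J'" "i \<noteq> k" "p \<in> Z i" "u \<in> Z k"
      consider "i \<in> J" "k \<in> J" | "i \<in> J" "k \<in> J'" | "i \<in> J'" "k \<in> J" | "i \<in> J'" "k \<in> J'"
        using * by blast
      then show "min (b i) (b k) \<le> d p u"
      proof cases
        case 1
        then show ?thesis using J * by (simp add: layered_def)
      next
        case 3
        then show ?thesis using sep[of k i u p] * by (simp add: commute min.commute)
      qed (use sep sep' * in blast)+
    qed
    show "\<forall>U t. (\<forall>p\<in>U. \<forall>u\<in>U. d p u \<le> t) \<longrightarrow>
        (\<Sum>i\<in>{i \<in> J \<union> J'. U \<inter> Z i \<noteq> {} \<and> b i \<le> t}. b i powr \<delta>) \<le> Suc l * Q * t powr \<delta>"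
      using 2 by blast
    have "l * q * R powr \<delta> \<le> (\<Sum>i\<in>J. b i powr \<delta>)" using J by (simp add: layered_def)
    then show "Suc l * q * R powr \<delta> \<le> (\<Sum>i\<in>J \<union> J'. b i powr \<delta>)"
      using 1 fin J'(1) dJ by (simp add: sum.union_disjoint algebra_simps)
    show "(\<Sum>i\<in>J \<union> J'. measure \<mu> (mball (z i) (3 * r i))) < measure \<mu> (mball z0 (R / 2)) / 2"
      using 3 fin J'(1) dJ by (simp add: sum.union_disjoint s_def B_def)
  qed
  then show ?thesis by blast
qed

lemma layered_exists:
  assumes z0: "z0 \<in> M" "0 < R" "R \<le> D"
  shows "\<exists>J. layered z0 R m l J"
proof (induction l)
  case 0
  have "0 < c * (R / 2) powr \<delta>" using c_pos z0 by simp
  also have "\<dots> \<le> measure \<mu> (mball z0 (R / 2))" using z0 by (intro lower) auto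
  finally have "layered z0 R m 0 {}" by (simp add: layered_def)
  then show ?case by blast
qed (use layered_Suc[OF z0] in blast)

end

section \<open>The pigeonhole step and nested balls\<close>

context shifted_balls
begin

text \<open>The bound \<open>1 / 2\<close> keeps \<open>\<kappa>\<close> below 1, so that sets
  meeting a light ball are smaller than the ball; the other bound lets the hits on balls with
  \<open>b i \<le> t\<close> use up at most half of the total weight.\<close>

definition \<kappa> :: real where "\<kappa> = min (1 / 2) (q / (2 * Q))"

lemma \<kappa>_pos: "0 < \<kappa>" and \<kappa>_less: "\<kappa> < 1" and \<kappa>_Q: "\<kappa> * Q \<le> q / 2"
proof -
  show "0 < \<kappa>" "\<kappa> < 1" using q_pos Q_pos by (auto simp: \<kappa>_def)
  have "\<kappa> * Q \<le> q / (2 * Q) * Q" using Q_pos by (intro mult_right_mono) (auto simp: \<kappa>_def)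
  then show "\<kappa> * Q \<le> q / 2" using Q_pos by simp
qed

text \<open>Partial sums, bounded uniformly in \<open>N\<close>, replace a series, so all counting
  concerns finite real sums.\<close>

definition load :: "(nat \<Rightarrow> 'a set) \<Rightarrow> (nat \<Rightarrow> real) \<Rightarrow> 'a set \<Rightarrow> nat \<Rightarrow> real" where
  "load U a B N = (\<Sum>j | j < N \<and> U j \<inter> B \<noteq> {}. a j)"

lemma load_mono:
  assumes "\<And>j. 0 \<le> a j" "N \<le> N'"
  shows "load U a B N \<le> load U a B N'"
  unfolding load_def using assms by (intro sum_mono2) auto

text \<open>Separation leaves at most one ball with \<open>b i > t\<close>, where the truncation
  charges no more than \<open>a\<close>; without it this ball alone could contribute an arbitrarily
  large \<open>\<kappa> * b i powr \<delta>\<close>. The remaining balls fall under the volume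
  clause of \<open>layered\<close>.\<close>

lemma truncated_hits_le:
  assumes J: "layered z0 R m l J" and a: "0 \<le> a"
    and diam: "\<And>p u. \<lbrakk>p \<in> U; u \<in> U\<rbrakk> \<Longrightarrow> d p u \<le> t"
  shows "(\<Sum>i\<in>J. if U \<inter> Z i \<noteq> {} then min a (\<kappa> * b i powr \<delta>) else 0) \<le> a + \<kappa> * (l * Q * t powr \<delta>)"
proof -
  have fin: "finite J" using J by (simp add: layered_def)
  let ?S = "{i \<in> J. U \<inter> Z i \<noteq> {} \<and> t < b i}" and ?L = "{i \<in> J. U \<inter> Z i \<noteq> {} \<and> b i \<le> t}"
  have "(\<Sum>i\<in>J. if U \<inter> Z i \<noteq> {} then min a (\<kappa> * b i powr \<delta>) else 0) =
      (\<Sum>i\<in>{i \<in> J. U \<inter> Z i \<noteq> {}}. min a (\<kappa> * b i powr \<delta>))"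
    using fin by (intro sum.inter_filter[symmetric])
  also have "{i \<in> J. U \<inter> Z i \<noteq> {}} = ?S \<union> ?L" by auto
  also have "(\<Sum>i\<in>?S \<union> ?L. min a (\<kappa> * b i powr \<delta>)) =
      (\<Sum>i\<in>?S. min a (\<kappa> * b i powr \<delta>)) + (\<Sum>i\<in>?L. min a (\<kappa> * b i powr \<delta>))"
    using fin by (intro sum.union_disjoint) auto
  also have "(\<Sum>i\<in>?S. min a (\<kappa> * b i powr \<delta>)) \<le> a"
  proof (rule sum_le_single)
    fix i k assume ik: "i \<in> ?S" "k \<in> ?S"
    then obtain p u where pu: "p \<in> U" "p \<in> Z i" "u \<in> U" "u \<in> Z k" by blast
    show "i = k"
    proof (rule ccontr)
      assume "i \<noteq> k"
      then have "min (b i) (b k) \<le> d p u"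
        using J ik pu(2,4) by (simp add: layered_def)
      then show False using diam[OF pu(1,3)] ik by (simp add: min_def split: if_splits)
    qed
  qed (use a in auto)
  also have "(\<Sum>i\<in>?L. min a (\<kappa> * b i powr \<delta>)) \<le> (\<Sum>i\<in>?L. \<kappa> * b i powr \<delta>)"
    by (intro sum_mono) auto
  also have "\<dots> = \<kappa> * (\<Sum>i\<in>?L. b i powr \<delta>)" by (simp add: sum_distrib_left)
  also have "(\<Sum>i\<in>?L. b i powr \<delta>) \<le> l * Q * t powr \<delta>"
    using J diam by (simp add: layered_def)
  finally show ?thesis using \<kappa>_pos by simp
qed

text \<open>
  If every ball of a layered family were overloaded, then summing the truncated costs over the
  family and counting by the sets \<open>U j\<close> instead would bound its total weight \<open>l q R\<^sup>\<delta>\<close> by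
  \<open>T + l \<kappa> Q R\<^sup>\<delta> \<le> T + l q R\<^sup>\<delta> / 2\<close>, which fails for large \<open>l\<close>.
\<close>

lemma light_ball_exists:
  assumes z0: "z0 \<in> M" "0 < R" "R \<le> D" and T: "0 < T"
    and a: "\<And>j. 0 \<le> a j" and diam: "\<And>j p u. \<lbrakk>p \<in> U j; u \<in> U j\<rbrakk> \<Longrightarrow> d p u \<le> t j"
    and light: "\<And>N. load U a (mball z0 R) N \<le> \<kappa> * T"
    and large: "\<And>j. U j \<inter> mball z0 R \<noteq> {} \<Longrightarrow> T * t j powr \<delta> \<le> a j * R powr \<delta>"
  shows "\<exists>i\<ge>m. r i \<le> D \<and> mcball (z i) (r i) \<subseteq> mball z0 R \<and>
    (\<forall>N. load U a (mball (z i) (r i)) N \<le> \<kappa> * b i powr \<delta>)"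
proof (rule ccontr)
  assume "\<not> ?thesis"
  then have heavy: "\<exists>N. \<kappa> * b i powr \<delta> < load U a (mball (z i) (r i)) N"
    if "m \<le> i" "r i \<le> D" "mcball (z i) (r i) \<subseteq> mball z0 R" for i
    using that by (meson not_less)
  have R\<delta>: "0 < R powr \<delta>" using z0 by simp
  \<comment> \<open>As \<open>T\<close> may be much larger than \<open>R powr \<delta>\<close>, the
    number of layers has to depend on their ratio.\<close>
  obtain l :: nat where "2 * T / (q * R powr \<delta>) < l" using reals_Archimedean2 by blast
  then have l: "2 * T < l * (q * R powr \<delta>)"
    using q_pos R\<delta> by (simp add: divide_less_eq)
  obtain J where J: "layered z0 R m l J" using layered_exists[OF z0] by blast
  have fin: "finite J" using J by (simp add: layered_def)
  have Ji: "m \<le> i" "r i \<le> D" "mcball (z i) (r i) \<subseteq> mball z0 R" "Z i \<subseteq> mball z0 R" if i: "i \<in> J" for i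
  proof -
    have *: "m \<le> i" "r i \<le> b i" "b i \<le> D" "W i \<subseteq> mball z0 (R / 2)"
      using J i by (auto simp: layered_def)
    show "m \<le> i" "r i \<le> D" using * by auto
    have "mcball (z i) (r i) \<subseteq> mball (z i) (2 * b i)"
      using * radii_pos(2)[of i] by (intro mcball_subset_mball_concentric) auto
    also have "\<dots> \<subseteq> W i" by (rule mball_subset_W)
    also have "\<dots> \<subseteq> mball z0 (R / 2)" by fact
    also have "\<dots> \<subseteq> mball z0 R" using z0 by (intro mball_subset_concentric) auto
    finally show "mcball (z i) (r i) \<subseteq> mball z0 R" .
    then show "Z i \<subseteq> mball z0 R" unfolding Z_def using mball_subset_mcball by blast
  qed
  have "\<forall>i\<in>J. \<exists>N. \<kappa> * b i powr \<delta> < load U a (mball (z i) (r i)) N"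
    using heavy Ji by blast
  then obtain N where N: "\<And>i. i \<in> J \<Longrightarrow> \<kappa> * b i powr \<delta> < load U a (mball (z i) (r i)) (N i)"
    by metis
  \<comment> \<open>A common cut-off: finitely many covering sets already overload every ball of
    \<open>J\<close>, so the double sum is finite and may be swapped.\<close>
  define N0 where "N0 = Max (insert 0 (N ` J))"
  define A where "A = {j. j < N0 \<and> U j \<inter> mball z0 R \<noteq> {}}"
  have finA: "finite A" by (simp add: A_def)
  have "\<kappa> * b i powr \<delta> \<le> (\<Sum>j\<in>A. if U j \<inter> Z i \<noteq> {} then min (a j) (\<kappa> * b i powr \<delta>) else 0)"
    if i: "i \<in> J" for i
  proof -
    let ?S = "{j \<in> A. U j \<inter> Z i \<noteq> {}}"
    have "N i \<le> N0" using i fin by (auto simp: N0_def)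
    then have "\<kappa> * b i powr \<delta> \<le> load U a (mball (z i) (r i)) N0"
      using N[OF i] load_mono[of a "N i" N0] a by (meson less_imp_le order_trans)
    also have "\<dots> = (\<Sum>j\<in>?S. a j)"
      unfolding load_def A_def using Ji(4)[OF i] by (intro sum.cong) (auto simp: Z_def simp del: in_mball)
    finally have "\<kappa> * b i powr \<delta> \<le> (\<Sum>j\<in>?S. min (a j) (\<kappa> * b i powr \<delta>))"
      using finA a \<kappa>_pos by (intro le_sum_min) auto
    then show ?thesis using finA by (simp add: sum.inter_filter)
  qed
  then have "(\<Sum>i\<in>J. \<kappa> * b i powr \<delta>) \<le>
      (\<Sum>i\<in>J. \<Sum>j\<in>A. if U j \<inter> Z i \<noteq> {} then min (a j) (\<kappa> * b i powr \<delta>) else 0)"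
    by (rule sum_mono)
  also have "\<dots> = (\<Sum>j\<in>A. \<Sum>i\<in>J. if U j \<inter> Z i \<noteq> {} then min (a j) (\<kappa> * b i powr \<delta>) else 0)"
    by (rule sum.swap)
  \<comment> \<open>The term 1 is the single hit with \<open>b i > t j\<close>; for the other hits,
    \<open>large\<close> converts \<open>t j powr \<delta>\<close> into a multiple of the cost
    \<open>a j\<close>.\<close>
  also have "\<dots> \<le> (\<Sum>j\<in>A. (1 + \<kappa> * l * Q * R powr \<delta> / T) * a j)"
  proof (rule sum_mono)
    fix j assume j: "j \<in> A"
    have "T * t j powr \<delta> \<le> a j * R powr \<delta>" using large j by (simp add: A_def)
    then have "t j powr \<delta> \<le> a j * R powr \<delta> / T" using T by (simp add: field_simps)
    then have "\<kappa> * (l * Q * t j powr \<delta>) \<le> \<kappa> * (l * Q * (a j * R powr \<delta> / T))"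
      using \<kappa>_pos Q_pos by (intro mult_left_mono) auto
    then show "(\<Sum>i\<in>J. if U j \<inter> Z i \<noteq> {} then min (a j) (\<kappa> * b i powr \<delta>) else 0)
        \<le> (1 + \<kappa> * l * Q * R powr \<delta> / T) * a j"
      using truncated_hits_le[OF J a[of j], where U = "U j" and t = "t j", OF diam] by (simp add: algebra_simps)
  qed
  also have "\<dots> = (1 + \<kappa> * l * Q * R powr \<delta> / T) * load U a (mball z0 R) N0"
    by (simp add: load_def A_def sum_distrib_left)
  \<comment> \<open>The ambient load carries the same factor \<open>\<kappa>\<close> as the demand
    of each ball in \<open>J\<close>, so the factor cancels below.\<close>
  also have "\<dots> \<le> (1 + \<kappa> * l * Q * R powr \<delta> / T) * (\<kappa> * T)"
    using light \<kappa>_pos Q_pos R\<delta> T by (intro mult_left_mono add_nonneg_nonneg) auto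
  also have "\<dots> = \<kappa> * (T + l * (\<kappa> * Q) * R powr \<delta>)"
    using T by (simp add: field_simps)
  finally have "(\<Sum>i\<in>J. b i powr \<delta>) \<le> T + l * (\<kappa> * Q) * R powr \<delta>"
    using \<kappa>_pos by (simp flip: sum_distrib_left)
  moreover have "l * (\<kappa> * Q) * R powr \<delta> \<le> l * (q / 2) * R powr \<delta>"
    using \<kappa>_Q by (intro mult_right_mono mult_left_mono) auto
  moreover have "l * q * R powr \<delta> \<le> (\<Sum>i\<in>J. b i powr \<delta>)"
    using J by (simp add: layered_def)
  ultimately show False using l by (simp add: algebra_simps)
qed

text \<open>The centres form a Cauchy sequence in \<open>B\<close>. Its limit lies in every closed
  ball, hence, since each closed ball sits in the preceding open one, in all the open balls.\<close>

lemma nested_balls_point: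
  assumes nested: "\<And>k. mcball (z (\<sigma> (Suc k))) (r (\<sigma> (Suc k))) \<subseteq> mball (z (\<sigma> k)) (r (\<sigma> k))"
    and r: "(\<lambda>k. r (\<sigma> k)) \<longlonglongrightarrow> 0" and B: "mball (z (\<sigma> 0)) (r (\<sigma> 0)) \<subseteq> B"
    and complete: "\<And>s. \<lbrakk>MCauchy s; range s \<subseteq> B\<rbrakk> \<Longrightarrow> \<exists>p. limitin mtopology s p sequentially"
  obtains p where "\<And>k. p \<in> mball (z (\<sigma> k)) (r (\<sigma> k))"
proof -
  define s where "s k = z (\<sigma> k)" for k
  have dec: "mball (z (\<sigma> l)) (r (\<sigma> l)) \<subseteq> mball (z (\<sigma> k)) (r (\<sigma> k))" if "k \<le> l" for k l
    using that
  proof (induction l rule: dec_induct)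
    case (step l)
    then show ?case using nested[of l] mball_subset_mcball by blast
  qed simp
  have s_in: "s l \<in> mball (z (\<sigma> k)) (r (\<sigma> k))" if "k \<le> l" for k l
    by (rule subsetD[OF dec[OF that]]) (use centres radii_pos in \<open>simp add: s_def\<close>)
  have "MCauchy s"
    unfolding MCauchy_def
  proof (intro conjI allI impI)
    show "range s \<subseteq> M" using centres by (auto simp: s_def)
    fix e :: real assume e: "0 < e"
    obtain k where k: "r (\<sigma> k) < e / 2"
      using order_tendstoD(2)[OF r, of "e / 2"] e unfolding eventually_sequentially by auto
    have "d (s i) (s j) < e" if "k \<le> i" "k \<le> j" for i j
      using s_in[OF that(1)] s_in[OF that(2)] k triangle[of "s i" "z (\<sigma> k)" "s j"]
        commute[of "s i" "z (\<sigma> k)"] by auto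
    then show "\<exists>N. \<forall>n n'. N \<le> n \<longrightarrow> N \<le> n' \<longrightarrow> d (s n) (s n') < e" by blast
  qed
  moreover have "range s \<subseteq> B" using s_in[of 0] B by auto
  ultimately obtain p where p: "limitin mtopology s p sequentially" using complete by blast
  have "p \<in> mball (z (\<sigma> k)) (r (\<sigma> k))" for k
  proof -
    have "p \<in> mcball (z (\<sigma> (Suc k))) (r (\<sigma> (Suc k)))"
    proof (rule limitin_closedin[OF p closedin_mcball])
      have "s l \<in> mcball (z (\<sigma> (Suc k))) (r (\<sigma> (Suc k)))" if "Suc k \<le> l" for l
        using s_in[OF that] mball_subset_mcball by blast
      then show "\<forall>\<^sub>F l in sequentially. s l \<in> mcball (z (\<sigma> (Suc k))) (r (\<sigma> (Suc k)))"
        unfolding eventually_sequentially by blast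
    qed simp
    then show ?thesis using nested by blast
  qed
  then show ?thesis using that by blast
qed

end

section \<open>Infinite measure in the unbounded case\<close>

lemma mem_limsup_sets: "p \<in> limsup A \<longleftrightarrow> (\<forall>n. \<exists>i\<ge>n. p \<in> A i)"
  for A :: "nat \<Rightarrow> 'a set"
  unfolding limsup_INF_SUP by auto

text \<open>It allows a bound on the shifts that holds from some index on to be assumed from the
  start.\<close>

lemma limsup_sets_shift: "limsup (\<lambda>i. A (i + k)) = limsup A"
  for A :: "nat \<Rightarrow> 'a set"
proof (intro Set.set_eqI iffI)
  fix p assume p: "p \<in> limsup A"
  show "p \<in> limsup (\<lambda>i. A (i + k))"
    unfolding mem_limsup_sets
  proof
    fix n
    from p have "\<exists>i\<ge>n + k. p \<in> A i" unfolding mem_limsup_sets ..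
    then obtain i where "n + k \<le> i" "p \<in> A i" by blast
    then show "\<exists>i\<ge>n. p \<in> A (i + k)" by (intro exI[of _ "i - k"]) auto
  qed
next
  fix p assume p: "p \<in> limsup (\<lambda>i. A (i + k))"
  show "p \<in> limsup A"
    unfolding mem_limsup_sets
  proof
    fix n
    from p have "\<exists>i\<ge>n. p \<in> A (i + k)" unfolding mem_limsup_sets ..
    then obtain i where "n \<le> i" "p \<in> A (i + k)" by blast
    then show "\<exists>i\<ge>n. p \<in> A i" by (intro exI[of _ "i + k"]) auto
  qed
qed

text \<open>The bound \<open>K\<close> is the same at all scales, so the scale can later be chosen
  in terms of \<open>K\<close>. Diameters are replaced by positive numbers \<open>t j\<close>, as
  \<open>powr\<close> and monotonicity are used on positive arguments only. The value
  \<open>h + 3\<close> consists of \<open>h + 1\<close> for a near-optimal cover and 2 for this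
  replacement.\<close>

lemma (in Metric_space) hausdorff_measure_finite_covers:
  fixes f :: "real \<Rightarrow> real"
  assumes fin: "hausdorff_measure M d f A \<noteq> \<infinity>"
    and f: "\<And>t. 0 < t \<Longrightarrow> 0 < f t" "(f \<longlongrightarrow> 0) (at_right 0)"
  shows "\<exists>K>0. \<forall>\<rho>>0. \<exists>U t. A \<subseteq> (\<Union>j. U j) \<and> (\<forall>j :: nat. 0 < t j \<and> t j \<le> \<rho> \<and> (\<forall>p\<in>U j. \<forall>u\<in>U j. d p u \<le> t j)) \<and>
           (\<forall>N. (\<Sum>j<N. f (t j)) \<le> K)"
proof -
  let ?cost = "\<lambda>U. if mdiam d U = 0 then 0 else ennreal (f (mdiam d U))"
  obtain h where h: "0 \<le> h" "hausdorff_measure M d f A = ennreal h"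
    using fin by (cases "hausdorff_measure M d f A" rule: ennreal_cases) (auto simp: infinity_ennreal_def)
  have "\<exists>U t. A \<subseteq> (\<Union>j. U j) \<and> (\<forall>j :: nat. 0 < t j \<and> t j \<le> \<rho> \<and> (\<forall>p\<in>U j. \<forall>u\<in>U j. d p u \<le> t j)) \<and>
           (\<forall>N. (\<Sum>j<N. f (t j)) \<le> h + 3)" if \<rho>: "0 < \<rho>" for \<rho>
  proof -
    have "hausdorff_premeasure M d f \<rho> A \<le> ennreal h"
      unfolding h(2)[symmetric] hausdorff_measure_def using \<rho> by (intro SUP_upper) auto
    also have "\<dots> < ennreal (h + 1)" using h(1) by (simp add: ennreal_less_iff)
    finally obtain U where U: "A \<subseteq> (\<Union>j. U j)"
        "\<And>j. U j \<subseteq> M \<and> mbounded (U j) \<and> mdiam d (U j) \<le> \<rho>"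
        "(\<Sum>j. ?cost (U j)) < ennreal (h + 1)"
      unfolding hausdorff_premeasure_def INF_less_iff by auto
    \<comment> \<open>Sets of diameter 0 receive sizes \<open>\<tau> j\<close> of total cost at most
      \<open>\<Sum> (1/2) ^ j \<le> 2\<close>.\<close>
    have "\<forall>j :: nat. \<exists>\<tau>. 0 < \<tau> \<and> \<tau> \<le> \<rho> \<and> f \<tau> \<le> (1/2) ^ j"
    proof
      fix j :: nat
      have "\<forall>\<^sub>F t in at_right 0. f t < (1/2) ^ j"
        using order_tendstoD(2)[OF f(2)] by simp
      then obtain e where e: "0 < e" "\<And>t. 0 < t \<Longrightarrow> t < e \<Longrightarrow> f t < (1/2) ^ j"
        unfolding eventually_at_right_field by blast
      have "f (min \<rho> (e / 2)) < (1/2) ^ j" using e(1) \<rho> by (intro e(2)) auto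
      then show "\<exists>\<tau>. 0 < \<tau> \<and> \<tau> \<le> \<rho> \<and> f \<tau> \<le> (1/2) ^ j"
        using e(1) \<rho> by (intro exI[of _ "min \<rho> (e / 2)"]) auto
    qed
    from choice[OF this] obtain \<tau> where "\<forall>j :: nat. 0 < \<tau> j \<and> \<tau> j \<le> \<rho> \<and> f (\<tau> j) \<le> (1/2) ^ j" ..
    then have \<tau>: "0 < \<tau> j \<and> \<tau> j \<le> \<rho> \<and> f (\<tau> j) \<le> (1/2) ^ j" for j ..
    define t where "t j = (if mdiam d (U j) = 0 then \<tau> j else mdiam d (U j))" for j
    have nonneg_diam: "0 \<le> mdiam d (U j)" for j using U(2) mdiam_nonneg by blast
    have t: "0 < t j" "t j \<le> \<rho>" for j
      using U(2)[of j] \<tau>[of j] nonneg_diam[of j] by (auto simp: t_def)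
    have diam: "d p u \<le> t j" if "p \<in> U j" "u \<in> U j" for j p u
      using dist_le_mdiam[of "U j" p u] U(2)[of j] that \<tau>[of j] by (auto simp: t_def split: if_splits)
    have "(\<Sum>j<N. f (t j)) \<le> h + 3" for N
    proof -
      have "(\<Sum>j<N. f (t j)) \<le> (\<Sum>j<N. enn2real (?cost (U j)) + (1/2) ^ j)"
      proof (rule sum_mono)
        fix j
        show "f (t j) \<le> enn2real (?cost (U j)) + (1/2) ^ j"
          using \<tau>[of j] f(1)[of "mdiam d (U j)"] nonneg_diam[of j] by (auto simp: t_def)
      qed
      also have "\<dots> = (\<Sum>j<N. enn2real (?cost (U j))) + (\<Sum>j<N. (1/2 :: real) ^ j)"
        by (rule sum.distrib)
      also have "(\<Sum>j<N. (1/2 :: real) ^ j) \<le> 2"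
        using geometric_sum[of "1/2 :: real" N] by simp
      also have "(\<Sum>j<N. enn2real (?cost (U j))) \<le> h + 1"
      proof -
        have "ennreal (\<Sum>j<N. enn2real (?cost (U j))) = (\<Sum>j<N. ennreal (enn2real (?cost (U j))))"
          by (intro sum_ennreal[symmetric]) auto
        also have "\<dots> = (\<Sum>j<N. ?cost (U j))"
          by (intro sum.cong) (auto simp: ennreal_enn2real_if)
        also have "\<dots> \<le> (\<Sum>j. ?cost (U j))" by (intro sum_le_suminf) auto
        finally show ?thesis using U(3) h(1) by (simp add: ennreal_le_iff[symmetric] del: ennreal_le_iff)
      qed
      finally show ?thesis by simp
    qed
    then show ?thesis using U(1) t diam by (intro exI[of _ U] exI[of _ t]) blast
  qed
  then show ?thesis using h(1) by (intro exI[of _ "h + 3"]) auto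
qed

text \<open>The form in which local compactness enters: it passes to maximum metrics coordinate by
  coordinate and gives nested balls a common point.\<close>

definition (in Metric_space) locally_complete :: bool where
  "locally_complete \<longleftrightarrow> (\<forall>y\<in>M. \<exists>s>0. \<forall>\<sigma>. MCauchy \<sigma> \<and> range \<sigma> \<subseteq> mball y s \<longrightarrow>
     (\<exists>p. limitin mtopology \<sigma> p sequentially))"

lemma (in shifted_balls) hausdorff_measure_limsup_infinite:
  fixes f :: "real \<Rightarrow> real"
  assumes f: "mono_on {0<..} f" "\<And>t. 0 < t \<Longrightarrow> 0 < f t" "(f \<longlongrightarrow> 0) (at_right 0)"
    and b: "\<And>i. b i powr \<delta> = f (r i)"
    and anti: "antimono_on {0<..} (\<lambda>t. t powr (- \<delta>) * f t)"
    and unbounded: "\<And>K. \<exists>\<rho>>0. \<forall>t. 0 < t \<and> t \<le> \<rho> \<longrightarrow> K * t powr \<delta> \<le> f t"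
    and complete: locally_complete and y: "y \<in> M" "0 < s"
  shows "hausdorff_measure M d f (mball y s \<inter> limsup (\<lambda>i. mball (z i) (r i))) = \<infinity>"
proof (rule ccontr)
  assume fin: "\<not> ?thesis"
  obtain K where K: "0 < K" "\<And>\<rho>. 0 < \<rho> \<Longrightarrow> \<exists>U t. mball y s \<inter> limsup (\<lambda>i. mball (z i) (r i)) \<subseteq> (\<Union>j. U j) \<and>
      (\<forall>j :: nat. 0 < t j \<and> t j \<le> \<rho> \<and> (\<forall>p\<in>U j. \<forall>u\<in>U j. d p u \<le> t j)) \<and> (\<forall>N. (\<Sum>j<N. f (t j)) \<le> K)"
    using hausdorff_measure_finite_covers[OF fin f(2,3)] by blast
  obtain s1 where s1: "0 < s1" "\<forall>\<sigma>. MCauchy \<sigma> \<and> range \<sigma> \<subseteq> mball y s1 \<longrightarrow> (\<exists>p. limitin mtopology \<sigma> p sequentially)"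
    using bspec[OF complete[unfolded locally_complete_def] y(1)] by (elim exE conjE) (rule that)
  define s0 where "s0 = min (min s s1) D"
  have s0: "0 < s0" "s0 \<le> s" "s0 \<le> s1" "s0 \<le> D" using s1(1) y(2) D_pos by (auto simp: s0_def)
  \<comment> \<open>The whole cover then has load at most \<open>K = \<kappa> * T\<close> in the
    initial ball.\<close>
  define T where "T = K / \<kappa>"
  have T: "0 < T" using K(1) \<kappa>_pos by (simp add: T_def)
  \<comment> \<open>Covering sets below this scale satisfy the hypothesis \<open>large\<close> of
    \<open>light_ball_exists\<close> for the initial ball; at later stages it comes from
    \<open>anti\<close>.\<close>
  obtain \<rho> where \<rho>: "0 < \<rho>" "\<And>t. \<lbrakk>0 < t; t \<le> \<rho>\<rbrakk> \<Longrightarrow> T / s0 powr \<delta> * t powr \<delta> \<le> f t"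
    using unbounded[of "T / s0 powr \<delta>"] by blast
  obtain U t where cover: "mball y s \<inter> limsup (\<lambda>i. mball (z i) (r i)) \<subseteq> (\<Union>j. U j)"
      and t: "\<And>j :: nat. 0 < t j" "\<And>j. t j \<le> \<rho>"
      and diam: "\<And>j p u. \<lbrakk>p \<in> U j; u \<in> U j\<rbrakk> \<Longrightarrow> d p u \<le> t j"
      and sum_le: "\<And>N. (\<Sum>j<N. f (t j)) \<le> K"
    using K(2)[OF \<rho>(1)] by blast
  define a where "a j = f (t j)" for j
  have a: "0 < a j" "0 \<le> a j" for j using f(2)[OF t(1)] by (auto simp: a_def less_imp_le)
  define light where "light i \<longleftrightarrow> r i \<le> D \<and> mcball (z i) (r i) \<subseteq> mball y s0 \<and>
      (\<forall>N. load U a (mball (z i) (r i)) N \<le> \<kappa> * b i powr \<delta>)" for i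
  have heavy_hit: "a j \<le> \<kappa> * b i powr \<delta>" if "light i" "U j \<inter> mball (z i) (r i) \<noteq> {}" for i j
  proof -
    have "a j \<le> load U a (mball (z i) (r i)) (Suc j)"
      unfolding load_def using that a by (intro member_le_sum) auto
    also have "\<dots> \<le> \<kappa> * b i powr \<delta>" using that by (simp add: light_def)
    finally show ?thesis .
  qed
  have start: "\<exists>i. light i"
  proof -
    have light0: "load U a (mball y s0) N \<le> \<kappa> * T" for N
    proof -
      have "load U a (mball y s0) N \<le> (\<Sum>j<N. a j)"
        unfolding load_def using a by (intro sum_mono2) auto
      then show ?thesis using sum_le[of N] \<kappa>_pos by (simp add: T_def a_def)
    qed
    have large0: "T * t j powr \<delta> \<le> a j * s0 powr \<delta>" for j
      using \<rho>(2)[OF t] s0(1) by (simp add: a_def field_simps)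
    show ?thesis
      using light_ball_exists[OF y(1) s0(1,4) T a(2) diam light0 large0, of 0] by (auto simp: light_def)
  qed
  have step: "\<exists>i'. light i' \<and> i < i' \<and> mcball (z i') (r i') \<subseteq> mball (z i) (r i)" if i: "light i" for i
  proof -
    have rD: "r i \<le> D" using i by (simp add: light_def)
    \<comment> \<open>A set meeting a light ball costs less than \<open>f (r i)\<close>, so
      \<open>t j < r i\<close> as \<open>f\<close> is nondecreasing; then \<open>anti\<close>
      compares \<open>f (t j) / t j powr \<delta>\<close> with
      \<open>f (r i) / r i powr \<delta>\<close>.\<close>
    have large: "b i powr \<delta> * t j powr \<delta> \<le> a j * r i powr \<delta>" if hit: "U j \<inter> mball (z i) (r i) \<noteq> {}" for j
    proof -
      have pos: "0 < f (r i)" using f(2) radii_pos(1) by simp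
      have "f (t j) \<le> \<kappa> * f (r i)" using heavy_hit[OF i hit] b by (simp add: a_def)
      also have "\<dots> < f (r i)" using \<kappa>_less pos by simp
      finally have "\<not> r i \<le> t j"
        using monotone_onD[OF f(1), of "r i" "t j"] radii_pos t by force
      then have "r i powr (- \<delta>) * f (r i) \<le> t j powr (- \<delta>) * f (t j)"
        using monotone_onD[OF anti, of "t j" "r i"] radii_pos t by auto
      then show ?thesis
        using radii_pos(1)[of i] t(1)[of j] b by (simp add: a_def powr_minus field_simps)
    qed
    have load_le: "load U a (mball (z i) (r i)) N \<le> \<kappa> * b i powr \<delta>" for N
      using i by (simp add: light_def)
    have pos: "0 < b i powr \<delta>" using radii_pos(2)[of i] by simp
    have "\<exists>i'\<ge>Suc i. r i' \<le> D \<and> mcball (z i') (r i') \<subseteq> mball (z i) (r i) \<and>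
        (\<forall>N. load U a (mball (z i') (r i')) N \<le> \<kappa> * b i' powr \<delta>)"
      by (rule light_ball_exists[OF centres(2) radii_pos(1) rD pos a(2) diam load_le large])
    then obtain i' where i': "Suc i \<le> i'" "r i' \<le> D" "mcball (z i') (r i') \<subseteq> mball (z i) (r i)"
        "\<forall>N. load U a (mball (z i') (r i')) N \<le> \<kappa> * b i' powr \<delta>"
      by blast
    have "mball (z i) (r i) \<subseteq> mball y s0" using i mball_subset_mcball unfolding light_def by blast
    then show ?thesis using i' unfolding light_def by (intro exI[of _ i']) auto
  qed
  obtain \<sigma> where \<sigma>: "\<And>k. light (\<sigma> k)" "\<And>k. \<sigma> k < \<sigma> (Suc k)"
      "\<And>k. mcball (z (\<sigma> (Suc k))) (r (\<sigma> (Suc k))) \<subseteq> mball (z (\<sigma> k)) (r (\<sigma> k))"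
    using dependent_nat_choice[of "\<lambda>_. light" "\<lambda>_ i i'. i < i' \<and> mcball (z i') (r i') \<subseteq> mball (z i) (r i)"] start step
    by metis
  have mono: "strict_mono \<sigma>" using \<sigma>(2) by (simp add: strict_mono_Suc_iff)
  have b_\<sigma>: "(\<lambda>k. b (\<sigma> k)) \<longlonglongrightarrow> 0"
    using LIMSEQ_subseq_LIMSEQ[OF b_tendsto mono] by (simp add: comp_def)
  have "(\<lambda>i. r i / b i * b i) \<longlonglongrightarrow> 0 * 0" by (intro tendsto_mult ratio_tendsto b_tendsto)
  moreover have "r i / b i * b i = r i" for i using radii_pos(2)[of i] by simp
  ultimately have "r \<longlonglongrightarrow> 0" by simp
  then have r_\<sigma>: "(\<lambda>k. r (\<sigma> k)) \<longlonglongrightarrow> 0"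
    using LIMSEQ_subseq_LIMSEQ[OF _ mono] by (simp add: comp_def)
  have sub: "mball (z (\<sigma> 0)) (r (\<sigma> 0)) \<subseteq> mball y s0"
    using \<sigma>(1)[of 0] mball_subset_mcball unfolding light_def by blast
  also have "\<dots> \<subseteq> mball y s1" using s0 by (intro mball_subset_concentric)
  finally obtain p where p: "\<And>k. p \<in> mball (z (\<sigma> k)) (r (\<sigma> k))"
    using nested_balls_point[OF \<sigma>(3) r_\<sigma> _ s1(2)[rule_format, OF conjI]] by (metis (no_types))
  have "p \<in> mball y s"
    using p[of 0] sub mball_subset_concentric[OF s0(2), of y] by blast
  moreover have "p \<in> limsup (\<lambda>i. mball (z i) (r i))"
    unfolding mem_limsup_sets using p strict_mono_imp_increasing[OF mono] by blast
  ultimately obtain j where j: "p \<in> U j" using cover by blast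
  \<comment> \<open>The set \<open>U j\<close> meets every ball of the chain, so its fixed positive
    cost lies below a sequence tending to \<open>0\<close>.\<close>
  have "(\<lambda>k. \<kappa> * b (\<sigma> k) powr \<delta>) \<longlonglongrightarrow> \<kappa> * 0 powr \<delta>"
    using \<delta>_pos b_\<sigma> radii_pos(2) by (intro tendsto_intros tendsto_powr') (auto simp: less_imp_le)
  moreover have "a j \<le> \<kappa> * b (\<sigma> k) powr \<delta>" for k
    using heavy_hit[OF \<sigma>(1), of j k] j p by blast
  ultimately have "a j \<le> \<kappa> * 0 powr \<delta>"
    by (intro tendsto_lowerbound[where f = "\<lambda>k. \<kappa> * b (\<sigma> k) powr \<delta>"]) auto
  then show False using a(1)[of j] by simp
qed

section \<open>The two growth regimes of the dimension function\<close>

context regular_metric_measure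
begin

lemma limsup_balls_null_mono:
  assumes full: "M - limsup (\<lambda>i. mball (x i) (b i)) \<in> null_sets \<mu>"
    and le: "\<And>i. m \<le> i \<Longrightarrow> b i \<le> b' i"
  shows "M - limsup (\<lambda>i. mball (x i) (b' i)) \<in> null_sets \<mu>"
proof (rule null_sets_subset[OF full])
  have [measurable]: "M \<in> sets \<mu>" by (intro openin_sets) auto
  show "M - limsup (\<lambda>i. mball (x i) (b' i)) \<in> sets \<mu>"
    unfolding limsup_INF_SUP by measurable
  have "limsup (\<lambda>i. mball (x i) (b i)) \<subseteq> limsup (\<lambda>i. mball (x i) (b' i))"
  proof
    fix p assume p: "p \<in> limsup (\<lambda>i. mball (x i) (b i))"
    show "p \<in> limsup (\<lambda>i. mball (x i) (b' i))"
      unfolding mem_limsup_sets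
    proof
      fix n
      from p have "\<exists>i\<ge>max m n. p \<in> mball (x i) (b i)" unfolding mem_limsup_sets ..
      then obtain i where "max m n \<le> i" "p \<in> mball (x i) (b i)" by blast
      then show "\<exists>i\<ge>n. p \<in> mball (x i) (b' i)"
        using le[of i] by (intro exI[of _ i]) auto
    qed
  qed
  then show "M - limsup (\<lambda>i. mball (x i) (b' i)) \<subseteq> M - limsup (\<lambda>i. mball (x i) (b i))" by blast
qed

theorem mass_transference_shifted:
  fixes x z :: "nat \<Rightarrow> 'a" and r :: "nat \<Rightarrow> real" and f :: "real \<Rightarrow> real"
  assumes centres: "\<And>i. x i \<in> M" "\<And>i. z i \<in> M"
    and r: "\<And>i. 0 < r i" "r \<longlonglongrightarrow> 0"
    and dimension: "dimension_function f"
    and monotonic: "mono_on {0<..} (\<lambda>t. t powr (- \<delta>) * f t) \<or> antimono_on {0<..} (\<lambda>t. t powr (- \<delta>) * f t)"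
    and full: "M - limsup (\<lambda>i. mball (x i) (f (r i) powr (1 / \<delta>))) \<in> null_sets \<mu>"
    and shift: "\<And>i. m \<le> i \<Longrightarrow> d (x i) (z i) \<le> C0 * f (r i) powr (1 / \<delta>)" and C0: "0 \<le> C0"
    and complete: locally_complete and y: "y \<in> M" "0 < s"
  shows "hausdorff_measure M d f (mball y s \<inter> limsup (\<lambda>i. mball (z i) (r i))) =
         hausdorff_measure M d f (mball y s)"
proof -
  have f: "mono_on {0<..} f" "\<And>t. 0 < t \<Longrightarrow> 0 < f t" "(f \<longlongrightarrow> 0) (at_right 0)"
    using dimension by (auto simp: dimension_function_def)
  show ?thesis
  proof (cases "\<exists>A. \<forall>t. 0 < t \<and> t \<le> 1 \<longrightarrow> f t \<le> A * t powr \<delta>")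
    case True
    then obtain A where A: "\<And>t. \<lbrakk>0 < t; t \<le> 1\<rbrakk> \<Longrightarrow> f t \<le> A * t powr \<delta>" by blast
    have A0: "0 < A" using A[of 1] f(2)[of 1] by simp
    define A' where "A' = A powr (1 / \<delta>)"
    have A': "0 < A'" using A0 by (simp add: A'_def)
    obtain m1 where m1: "\<And>i. m1 \<le> i \<Longrightarrow> r i < 1"
      using order_tendstoD(2)[OF r(2), of 1] unfolding eventually_sequentially by auto
    have b_le: "f (r i) powr (1 / \<delta>) \<le> A' * r i" if "m1 \<le> i" for i
    proof -
      have "f (r i) powr (1 / \<delta>) \<le> (A * r i powr \<delta>) powr (1 / \<delta>)"
        using A[OF r(1), of i] m1[OF that] f(2)[OF r(1), of i] \<delta>_pos by (intro powr_mono2) auto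
      also have "\<dots> = A' * r i"
        using A0 r(1)[of i] \<delta>_pos by (simp add: A'_def powr_mult powr_powr)
      finally show ?thesis .
    qed
    \<comment> \<open>Since \<open>f (r i) powr (1 / \<delta>) \<le> A' * r i\<close>, the shift
      needs \<open>C0 * A'\<close> and the radius of the shifted ball needs 1. One more
      \<open>A'\<close> makes the balls of the hypothesis \<open>full\<close> fit as well.\<close>
    define K where "K = (C0 + 1) * A' + 1"
    have K: "0 < K" using C0 A' by (auto simp: K_def intro!: add_nonneg_pos mult_nonneg_nonneg)
    have sub: "mball (z i) (r i) \<subseteq> mball (x i) (K * r i)" if i: "max m m1 \<le> i" for i
    proof (rule mball_subset)
      have "d (z i) (x i) \<le> C0 * f (r i) powr (1 / \<delta>)"
        using shift[of i] i commute[of "z i" "x i"] by simp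
      also have "\<dots> \<le> C0 * (A' * r i)" using b_le[of i] i C0 by (intro mult_left_mono) auto
      also have "\<dots> \<le> C0 * (A' * r i) + A' * r i" using A' r(1)[of i] by simp
      finally show "d (z i) (x i) + r i \<le> K * r i" by (simp add: K_def algebra_simps)
    qed (rule centres(1))
    have fullK: "M - limsup (\<lambda>i. mball (x i) (K * r i)) \<in> null_sets \<mu>"
    proof (rule limsup_balls_null_mono[OF full, of m1])
      fix i assume "m1 \<le> i"
      have "A' * r i \<le> K * r i" using C0 A' r(1)[of i] by (intro mult_right_mono) (auto simp: K_def algebra_simps)
      then show "f (r i) powr (1 / \<delta>) \<le> K * r i" using b_le[OF \<open>m1 \<le> i\<close>] by linarith
    qed
    show ?thesis
      using hausdorff_measure_limsup_comparable[OF centres r K sub fullK f(1) less_imp_le[OF f(2)] A]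
      by blast
  next
    case False
    \<comment> \<open>A nondecreasing quotient would be bounded by \<open>f 1\<close> on
      \<open>(0, 1]\<close>, which belongs to the first case.\<close>
    have anti: "antimono_on {0<..} (\<lambda>t. t powr (- \<delta>) * f t)"
      using monotonic
    proof
      assume mono: "mono_on {0<..} (\<lambda>t. t powr (- \<delta>) * f t)"
      have "f t \<le> f 1 * t powr \<delta>" if "0 < t" "t \<le> 1" for t
        using monotone_onD[OF mono, of t 1] that by (simp add: powr_minus field_simps)
      then show ?thesis using False by blast
    qed
    \<comment> \<open>A single point \<open>\<rho>\<close> with
      \<open>f \<rho> > K * \<rho> powr \<delta>\<close> suffices, because \<open>anti\<close>
      carries the inequality to all smaller arguments.\<close>
    have unbounded: "\<exists>\<rho>>0. \<forall>t. 0 < t \<and> t \<le> \<rho> \<longrightarrow> K * t powr \<delta> \<le> f t" for K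
    proof -
      obtain \<rho> where \<rho>: "0 < \<rho>" "\<rho> \<le> 1" "K * \<rho> powr \<delta> < f \<rho>" using False by (meson not_le)
      have "K * t powr \<delta> \<le> f t" if "0 < t" "t \<le> \<rho>" for t
      proof -
        have "K \<le> \<rho> powr (- \<delta>) * f \<rho>" using \<rho> by (simp add: powr_minus field_simps)
        also have "\<dots> \<le> t powr (- \<delta>) * f t" using monotone_onD[OF anti, of t \<rho>] that \<rho> by simp
        finally show ?thesis using that by (simp add: powr_minus field_simps)
      qed
      then show ?thesis using \<rho>(1) by blast
    qed
    define b where "b i = f (r i) powr (1 / \<delta>)" for i
    have b_pos: "0 < b i" for i using f(2)[OF r(1)[of i]] by (simp add: b_def)
    have b_powr: "b i powr \<delta> = f (r i)" for i
      using f(2)[OF r(1)[of i]] \<delta>_pos by (simp add: b_def powr_powr)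
    have "filterlim r (at_right 0) sequentially"
      using r by (simp add: tendsto_imp_filterlim_at_right)
    then have "(\<lambda>i. f (r i)) \<longlonglongrightarrow> 0" by (rule filterlim_compose[OF f(3)])
    then have "b \<longlonglongrightarrow> 0 powr (1 / \<delta>)"
      unfolding b_def using \<delta>_pos f(2)[OF r(1)] by (intro tendsto_powr') (auto simp: less_imp_le)
    then have b_lim: "b \<longlonglongrightarrow> 0" by simp
    have ratio: "(\<lambda>i. r i / b i) \<longlonglongrightarrow> 0"
    proof (rule order_tendstoI)
      fix e :: real assume "e < 0"
      moreover have "0 < r i / b i" for i using r(1) b_pos by simp
      ultimately show "\<forall>\<^sub>F i in sequentially. e < r i / b i" by (simp add: less_trans)
    next
      fix e :: real assume e: "0 < e"
      obtain \<rho> where \<rho>: "0 < \<rho>" "\<And>t. \<lbrakk>0 < t; t \<le> \<rho>\<rbrakk> \<Longrightarrow> (2 / e) powr \<delta> * t powr \<delta> \<le> f t"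
        using unbounded[of "(2 / e) powr \<delta>"] by blast
      show "\<forall>\<^sub>F i in sequentially. r i / b i < e"
        using order_tendstoD(2)[OF r(2) \<rho>(1)]
      proof eventually_elim
        case (elim i)
        have "2 / e * r i = ((2 / e * r i) powr \<delta>) powr (1 / \<delta>)"
          using e r(1)[of i] \<delta>_pos by (simp add: powr_powr)
        also have "(2 / e * r i) powr \<delta> = (2 / e) powr \<delta> * r i powr \<delta>"
          using e r(1)[of i] by (intro powr_mult)
        also have "((2 / e) powr \<delta> * r i powr \<delta>) powr (1 / \<delta>) \<le> b i"
          unfolding b_def using \<rho>(2)[OF r(1), of i] elim e \<delta>_pos by (intro powr_mono2) auto
        finally have "2 * r i \<le> e * b i" using e by (simp add: field_simps)
        then have "r i < e * b i" using r(1)[of i] by linarith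
        then show ?case using b_pos[of i] by (simp add: divide_less_eq)
      qed
    qed
    interpret shifted_balls M d \<mu> c C D \<delta> "\<lambda>i. x (i + m)" "\<lambda>i. z (i + m)" "\<lambda>i. r (i + m)" "\<lambda>i. b (i + m)" C0
    proof
      show "(\<lambda>i. b (i + m)) \<longlonglongrightarrow> 0" using LIMSEQ_ignore_initial_segment[OF b_lim] .
      show "(\<lambda>i. r (i + m) / b (i + m)) \<longlonglongrightarrow> 0" using LIMSEQ_ignore_initial_segment[OF ratio] .
      show "M - limsup (\<lambda>i. mball (x (i + m)) (b (i + m))) \<in> null_sets \<mu>"
        unfolding limsup_sets_shift[of "\<lambda>i. mball (x i) (b i)" m] using full by (simp add: b_def)
      show "d (x (i + m)) (z (i + m)) \<le> C0 * b (i + m)" for i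
        using shift by (simp add: b_def)
    qed (use centres r(1) b_pos C0 in auto)
    have "hausdorff_measure M d f (mball y s \<inter> limsup (\<lambda>i. mball (z (i + m)) (r (i + m)))) = \<infinity>"
      by (rule hausdorff_measure_limsup_infinite[OF f b_powr anti unbounded complete y])
    then have inf: "hausdorff_measure M d f (mball y s \<inter> limsup (\<lambda>i. mball (z i) (r i))) = \<infinity>"
      unfolding limsup_sets_shift[of "\<lambda>i. mball (z i) (r i)" m] .
    \<comment> \<open>The ball contains a set of infinite measure, so both sides are
      infinite.\<close>
    also have "\<dots> = hausdorff_measure M d f (mball y s)"
      using hausdorff_measure_mono[of "mball y s \<inter> limsup (\<lambda>i. mball (z i) (r i))" "mball y s" f] inf
      by (simp add: infinity_ennreal_def top_unique)
    finally show ?thesis .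
  qed
qed

end

section \<open>Products with the maximum metric and the main theorem\<close>

text \<open>A small ball lies in a compact set, where a Cauchy sequence has a convergent subsequence
  and so converges itself.\<close>

lemma (in Metric_space) locally_complete_if_locally_compact:
  assumes "locally_compact_space mtopology"
  shows locally_complete
  unfolding locally_complete_def
proof
  fix y assume "y \<in> M"
  then obtain V K where VK: "openin mtopology V" "compactin mtopology K" "y \<in> V" "V \<subseteq> K"
    using assms unfolding locally_compact_space_def by fastforce
  then obtain s where s: "0 < s" "mball y s \<subseteq> V" unfolding openin_mtopology by blast
  have "\<exists>p. limitin mtopology \<sigma> p sequentially" if \<sigma>: "MCauchy \<sigma>" "range \<sigma> \<subseteq> mball y s" for \<sigma>
  proof -
    have "range \<sigma> \<subseteq> K" using \<sigma>(2) s VK by blast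
    then obtain p l where "strict_mono l" "limitin mtopology (\<sigma> \<circ> l) p sequentially"
      using VK(2) unfolding compactin_sequentially by blast
    then show ?thesis using MCauchy_convergent_subsequence[OF \<sigma>(1)] by blast
  qed
  then show "\<exists>s>0. \<forall>\<sigma>. MCauchy \<sigma> \<and> range \<sigma> \<subseteq> mball y s \<longrightarrow> (\<exists>p. limitin mtopology \<sigma> p sequentially)"
    using s(1) by blast
qed

lemma max_dist_less_iff:
  assumes "finite I" "I \<noteq> {}"
  shows "max_dist I d x y < s \<longleftrightarrow> (\<forall>i\<in>I. d i (x i) (y i) < s)"
  unfolding max_dist_def using assms by (subst Max_less_iff) auto

context
  fixes I :: "'i set" and M :: "'i \<Rightarrow> 'a set" and d :: "'i \<Rightarrow> 'a \<Rightarrow> 'a \<Rightarrow> real"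
  assumes I: "finite I" "I \<noteq> {}" and metric: "\<And>i. i \<in> I \<Longrightarrow> Metric_space (M i) (d i)"
begin

interpretation prod: Metric_space "\<Pi>\<^sub>E i\<in>I. M i" "max_dist I d"
  using I metric by (rule Metric_space_max_dist)

text \<open>This makes balls measurable for the product measure, whose sigma-algebra contains the
  boxes.\<close>

lemma mball_max_dist:
  assumes y: "y \<in> (\<Pi>\<^sub>E i\<in>I. M i)"
  shows "prod.mball y s = (\<Pi>\<^sub>E i\<in>I. Metric_space.mball (M i) (d i) (y i) s)"
proof (rule Set.set_eqI)
  fix p
  have "p \<in> prod.mball y s \<longleftrightarrow> p \<in> (\<Pi>\<^sub>E i\<in>I. M i) \<and> (\<forall>i\<in>I. d i (y i) (p i) < s)"
    using y by (simp add: max_dist_less_iff[OF I])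
  also have "\<dots> \<longleftrightarrow> p \<in> (\<Pi>\<^sub>E i\<in>I. Metric_space.mball (M i) (d i) (y i) s)"
    using y by (auto simp: PiE_iff Metric_space.in_mball[OF metric])
  finally show "p \<in> prod.mball y s \<longleftrightarrow> p \<in> (\<Pi>\<^sub>E i\<in>I. Metric_space.mball (M i) (d i) (y i) s)" .
qed

text \<open>Finitely many coordinates allow a common radius and a common index from which all
  coordinates are close to their limits. The limit is restricted to \<open>I\<close> to make it
  extensional.\<close>

lemma locally_complete_max_dist:
  assumes complete: "\<And>i. i \<in> I \<Longrightarrow> Metric_space.locally_complete (M i) (d i)"
  shows prod.locally_complete
  unfolding prod.locally_complete_def
proof
  fix y assume y: "y \<in> (\<Pi>\<^sub>E i\<in>I. M i)"
  have "\<forall>i\<in>I. \<exists>s>0. \<forall>\<sigma>. Metric_space.MCauchy (M i) (d i) \<sigma> \<and> range \<sigma> \<subseteq> Metric_space.mball (M i) (d i) (y i) s \<longrightarrow>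
      (\<exists>p. limitin (Metric_space.mtopology (M i) (d i)) \<sigma> p sequentially)"
    using complete y Metric_space.locally_complete_def[OF metric] by (auto simp: PiE_iff)
  from bchoice[OF this] obtain s where s_all: "\<forall>i\<in>I. 0 < s i \<and> (\<forall>\<sigma>. Metric_space.MCauchy (M i) (d i) \<sigma> \<and> range \<sigma> \<subseteq> Metric_space.mball (M i) (d i) (y i) (s i) \<longrightarrow>
      (\<exists>p. limitin (Metric_space.mtopology (M i) (d i)) \<sigma> p sequentially))" ..
  have s: "\<And>i. i \<in> I \<Longrightarrow> 0 < s i"
      "\<And>i \<sigma>. \<lbrakk>i \<in> I; Metric_space.MCauchy (M i) (d i) \<sigma>; range \<sigma> \<subseteq> Metric_space.mball (M i) (d i) (y i) (s i)\<rbrakk> \<Longrightarrow>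
        \<exists>p. limitin (Metric_space.mtopology (M i) (d i)) \<sigma> p sequentially"
    using s_all by blast+
  define s0 where "s0 = Min (s ` I)"
  have s0: "0 < s0" "\<And>i. i \<in> I \<Longrightarrow> s0 \<le> s i" using I s(1) by (auto simp: s0_def)
  have "\<exists>p. limitin prod.mtopology \<sigma> p sequentially"
    if cauchy: "prod.MCauchy \<sigma>" and range: "range \<sigma> \<subseteq> prod.mball y s0" for \<sigma>
  proof -
    have \<sigma>_in: "\<sigma> n \<in> (\<Pi>\<^sub>E i\<in>I. M i)" for n
      using range prod.mball_subset_mspace by blast
    have "\<exists>p. limitin (Metric_space.mtopology (M i) (d i)) (\<lambda>n. \<sigma> n i) p sequentially" if i: "i \<in> I" for i
    proof (rule s(2)[OF i])
      interpret Mi: Metric_space "M i" "d i" using metric[OF i] .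
      show "Mi.MCauchy (\<lambda>n. \<sigma> n i)"
        unfolding Mi.MCauchy_def
      proof (intro conjI allI impI)
        show "range (\<lambda>n. \<sigma> n i) \<subseteq> M i" using \<sigma>_in i by (auto simp: PiE_iff)
        fix e :: real assume "0 < e"
        then obtain N where "\<And>n n'. N \<le> n \<Longrightarrow> N \<le> n' \<Longrightarrow> max_dist I d (\<sigma> n) (\<sigma> n') < e"
          using cauchy unfolding prod.MCauchy_def by meson
        then show "\<exists>N. \<forall>n n'. N \<le> n \<longrightarrow> N \<le> n' \<longrightarrow> d i (\<sigma> n i) (\<sigma> n' i) < e"
          using max_dist_less_iff[OF I, where d = d] i by blast
      qed
      show "range (\<lambda>n. \<sigma> n i) \<subseteq> Mi.mball (y i) (s i)"
      proof
        fix p assume "p \<in> range (\<lambda>n. \<sigma> n i)"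
        then obtain n where n: "p = \<sigma> n i" by blast
        have "\<sigma> n \<in> prod.mball y s0" using range by blast
        then have "\<sigma> n i \<in> Mi.mball (y i) s0" unfolding mball_max_dist[OF y] using i by (auto simp: PiE_iff)
        then show "p \<in> Mi.mball (y i) (s i)"
          using Mi.mball_subset_concentric[OF s0(2)[OF i]] n by blast
      qed
    qed
    then have "\<forall>i\<in>I. \<exists>p. limitin (Metric_space.mtopology (M i) (d i)) (\<lambda>n. \<sigma> n i) p sequentially" by blast
    from bchoice[OF this] obtain p where
      p: "\<And>i. i \<in> I \<Longrightarrow> limitin (Metric_space.mtopology (M i) (d i)) (\<lambda>n. \<sigma> n i) (p i) sequentially"
      by (elim exE) auto
    have "limitin prod.mtopology \<sigma> (restrict p I) sequentially"
      unfolding prod.limitin_metric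
    proof (intro conjI allI impI)
      have "p i \<in> M i" if i: "i \<in> I" for i
        using p[OF i] unfolding Metric_space.limitin_metric[OF metric[OF i]] by blast
      then show "restrict p I \<in> (\<Pi>\<^sub>E i\<in>I. M i)" by auto
      fix e :: real assume e: "0 < e"
      have "\<forall>\<^sub>F n in sequentially. d i (\<sigma> n i) (p i) < e" if i: "i \<in> I" for i
        using p[OF i] e unfolding Metric_space.limitin_metric[OF metric[OF i]]
        by (auto elim: eventually_mono)
      then have "\<forall>\<^sub>F n in sequentially. \<forall>i\<in>I. d i (\<sigma> n i) (p i) < e"
        using I(1) by (simp add: eventually_ball_finite_distrib)
      then show "\<forall>\<^sub>F n in sequentially. \<sigma> n \<in> (\<Pi>\<^sub>E i\<in>I. M i) \<and> max_dist I d (\<sigma> n) (restrict p I) < e"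
        by eventually_elim (use \<sigma>_in max_dist_less_iff[OF I, where d = d] in auto)
    qed
    then show ?thesis by blast
  qed
  then show "\<exists>s>0. \<forall>\<sigma>. prod.MCauchy \<sigma> \<and> range \<sigma> \<subseteq> prod.mball y s \<longrightarrow>
      (\<exists>p. limitin prod.mtopology \<sigma> p sequentially)"
    using s0(1) by blast
qed

lemma mbounded_max_dist:
  assumes "\<And>i. i \<in> I \<Longrightarrow> Metric_space.mbounded (M i) (d i) (M i)"
  shows "prod.mbounded (\<Pi>\<^sub>E i\<in>I. M i)"
proof -
  have "\<forall>i\<in>I. \<exists>B. \<forall>p\<in>M i. \<forall>u\<in>M i. d i p u < B"
  proof
    fix i assume i: "i \<in> I"
    obtain B where "\<forall>p\<in>M i. \<forall>u\<in>M i. d i p u \<le> B"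
      using assms[OF i] Metric_space.mbounded_alt[OF metric[OF i]] by blast
    then show "\<exists>B. \<forall>p\<in>M i. \<forall>u\<in>M i. d i p u < B" by (intro exI[of _ "B + 1"]) force
  qed
  from bchoice[OF this] obtain B where B: "\<forall>i\<in>I. \<forall>p\<in>M i. \<forall>u\<in>M i. d i p u < B i" ..
  have "max_dist I d p u < Max (B ` I)" if "p \<in> (\<Pi>\<^sub>E i\<in>I. M i)" "u \<in> (\<Pi>\<^sub>E i\<in>I. M i)" for p u
    using that B I unfolding max_dist_less_iff[OF I, where d = d]
    by (auto simp: PiE_iff intro!: less_le_trans[OF _ Max_ge])
  then show ?thesis unfolding prod.mbounded_alt by (intro conjI order_refl exI[of _ "Max (B ` I)"]) (auto intro: less_imp_le)
qed

end

text \<open>It turns the hypothesis on \<open>d(0, \<gamma>\<^sub>i)\<close> into a bound on the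
  displacement of the centres.\<close>

lemma max_dist_translate:
  assumes G: "\<And>k. k \<in> I \<Longrightarrow> invariant_metric_group (G k) (d k)"
    and x: "\<And>k. k \<in> I \<Longrightarrow> x k \<in> carrier (G k)" and \<gamma>: "\<gamma> \<in> carrier (product_group I G)"
  shows "max_dist I d x (x \<otimes>\<^bsub>product_group I G\<^esub> \<gamma>) = max_dist I d \<one>\<^bsub>product_group I G\<^esub> \<gamma>"
proof -
  have "d k (x k) (x k \<otimes>\<^bsub>G k\<^esub> \<gamma> k) = d k \<one>\<^bsub>G k\<^esub> (\<gamma> k)" if k: "k \<in> I" for k
  proof -
    interpret invariant_metric_group "G k" "d k" using G[OF k] .
    have mem: "x k \<in> carrier (G k)" "\<gamma> k \<in> carrier (G k)" using x[OF k] \<gamma> k by (auto simp: PiE_iff)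
    then have "d k (\<one>\<^bsub>G k\<^esub> \<otimes>\<^bsub>G k\<^esub> x k) (\<gamma> k \<otimes>\<^bsub>G k\<^esub> x k) = d k \<one>\<^bsub>G k\<^esub> (\<gamma> k)"
      by (intro translation_invariant) auto
    then show ?thesis using mem by (simp add: m_comm)
  qed
  then show ?thesis
    unfolding max_dist_def by (intro arg_cong[where f = Max] image_cong) auto
qed

theorem theorem3p3:
  fixes n :: nat
    and G :: "nat \<Rightarrow> ('a, 'b) monoid_scheme"
    and Xs :: "nat \<Rightarrow> 'a set"
    and ds :: "nat \<Rightarrow> 'a \<Rightarrow> 'a \<Rightarrow> real"
    and \<mu>s :: "nat \<Rightarrow> 'a measure"
    and \<delta>s :: "nat \<Rightarrow> real"
    and f :: "real \<Rightarrow> real"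
    and x \<gamma> :: "nat \<Rightarrow> nat \<Rightarrow> 'a"
    and r :: "nat \<Rightarrow> real"
  defines "X \<equiv> \<Pi>\<^sub>E k\<in>{1..n}. Xs k"
    and "d \<equiv> max_dist {1..n} ds"
    and "\<mu> \<equiv> \<Pi>\<^sub>M k\<in>{1..n}. \<mu>s k"
    and "\<delta> \<equiv> \<Sum>k=1..n. \<delta>s k"
    and "P \<equiv> product_group {1..n} G"
  assumes n: "1 \<le> n"
    and group: "\<And>k. k \<in> {1..n} \<Longrightarrow> invariant_metric_group (G k) (ds k)"
    and subset: "\<And>k. k \<in> {1..n} \<Longrightarrow> Xs k \<subseteq> carrier (G k)"
    and factor: "\<And>k. k \<in> {1..n} \<Longrightarrow> ahlfors_probability_space (Xs k) (ds k) (\<mu>s k) (\<delta>s k)"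
    and delta_pos: "0 < \<delta>"
    and regular: "ahlfors_regular X d \<mu> \<delta>"
    and centres: "\<And>i. x i \<in> X"
    and radii_pos: "\<And>i. 0 < r i"
    and radii_tendsto: "r \<longlonglongrightarrow> 0"
    and dimension: "dimension_function f"
    and monotonic: "mono_on {0<..} (\<lambda>t. t powr (- \<delta>) * f t) \<or>
                    antimono_on {0<..} (\<lambda>t. t powr (- \<delta>) * f t)"
    and full_measure:
      "\<And>y s. \<lbrakk>y \<in> X; 0 < s\<rbrakk> \<Longrightarrow>
         emeasure \<mu> (Metric_space.mball X d y s \<inter>
             limsup (\<lambda>i. Metric_space.mball X d (x i) (f (r i) powr (1 / \<delta>))))
         = emeasure \<mu> (Metric_space.mball X d y s)"
    and shifts: "\<And>i. \<gamma> i \<in> carrier P"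
    and shifted_centres: "\<And>i. x i \<otimes>\<^bsub>P\<^esub> \<gamma> i \<in> X"
    and shifts_bounded:
      "limsup (\<lambda>i. ereal (d \<one>\<^bsub>P\<^esub> (\<gamma> i) / f (r i) powr (1 / \<delta>))) < \<infinity>"
  shows "\<And>y s. \<lbrakk>y \<in> X; 0 < s\<rbrakk> \<Longrightarrow>
    hausdorff_measure X d f (Metric_space.mball X d y s \<inter>
        limsup (\<lambda>i. Metric_space.mball X d (x i \<otimes>\<^bsub>P\<^esub> \<gamma> i) (r i)))
    = hausdorff_measure X d f (Metric_space.mball X d y s)"
proof -
  fix y and s :: real assume y: "y \<in> X" "0 < s"
  have I: "finite {1..n}" "{1..n} \<noteq> {}" using n by auto
  have metric: "Metric_space (Xs k) (ds k)" if "k \<in> {1..n}" for k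
    using factor[OF that] by (simp add: ahlfors_probability_space_def)
  interpret X: Metric_space X d
    unfolding X_def d_def using I metric by (rule Metric_space_max_dist)
  interpret prob_space \<mu>
    unfolding \<mu>_def using factor by (intro prob_space_PiM) (simp add: ahlfors_probability_space_def)
  have ball_sets [measurable]: "X.mball p t \<in> sets \<mu>" for p t
  proof (cases "p \<in> X")
    case True
    have "Metric_space.mball (Xs k) (ds k) (p k) t \<in> sets (\<mu>s k)" if k: "k \<in> {1..n}" for k
    proof -
      interpret k: ahlfors_probability_space "Xs k" "ds k" "\<mu>s k" "\<delta>s k" using factor[OF k] .
      show ?thesis
        unfolding k.sets_borel
        by (intro in_measure_of) (use k.openin_mtopology k.openin_mball in blast)+
    qed
    then have "(\<Pi>\<^sub>E k\<in>{1..n}. Metric_space.mball (Xs k) (ds k) (p k) t) \<in> sets \<mu>"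
      unfolding \<mu>_def by (intro sets_PiM_I_finite) auto
    also have "(\<Pi>\<^sub>E k\<in>{1..n}. Metric_space.mball (Xs k) (ds k) (p k) t) = X.mball p t"
      unfolding X_def d_def by (rule mball_max_dist[OF I metric True[unfolded X_def], symmetric])
    finally show ?thesis .
  next
    case False
    then have "X.mball p t = {}" unfolding X.mball_eq_empty by blast
    then show ?thesis by simp
  qed
  have "X.mbounded X"
    unfolding X_def d_def using factor
    by (intro mbounded_max_dist[OF I metric])
      (auto simp: ahlfors_probability_space_def ahlfors_probability_space_axioms_def)
  then obtain B where B: "\<And>p u. \<lbrakk>p \<in> X; u \<in> X\<rbrakk> \<Longrightarrow> d p u \<le> B" unfolding X.mbounded_alt by blast
  \<comment> \<open>As the bounded space is itself a ball, the hypothesis on balls yields a conull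
    limsup set in all of \<open>X\<close>.\<close>
  have X_ball: "X.mball y (max B 0 + 1) = X" using B[OF y(1)] y(1) by force
  have complete: X.locally_complete
    unfolding X_def d_def
  proof (rule locally_complete_max_dist[OF I metric])
    fix k assume "k \<in> {1..n}"
    then interpret k: ahlfors_probability_space "Xs k" "ds k" "\<mu>s k" "\<delta>s k" by (rule factor)
    show k.locally_complete
      by (rule k.locally_complete_if_locally_compact[OF k.locally_compact])
  qed
  define L where "L = limsup (\<lambda>i. X.mball (x i) (f (r i) powr (1 / \<delta>)))"
  have L: "L \<in> sets \<mu>" unfolding L_def limsup_INF_SUP by measurable
  have "X \<in> sets \<mu>" using ball_sets[of y "max B 0 + 1"] X_ball by simp
  moreover from this have "emeasure \<mu> (X - X \<inter> L) = 0"
    using full_measure[OF y(1), of "max B 0 + 1"] L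
    by (subst emeasure_Diff) (auto simp: X_ball L_def)
  ultimately have full: "X - L \<in> null_sets \<mu>"
    using L by (intro null_setsI) (auto simp: Diff_Int_distrib2 Diff_Int)
  show "hausdorff_measure X d f (X.mball y s \<inter> limsup (\<lambda>i. X.mball (x i \<otimes>\<^bsub>P\<^esub> \<gamma> i) (r i))) =
      hausdorff_measure X d f (X.mball y s)"
  \<comment> \<open>The locale \<open>regular_metric_measure\<close> asks for a positive
    \<open>D\<close>. At diameter 0 the cover by \<open>X\<close> itself costs nothing, and both
    sides vanish.\<close>
  proof (cases "mdiam d X = 0")
    case True
    have null: "hausdorff_measure X d f A = 0" if "A \<subseteq> X" for A
    proof -
      have "hausdorff_premeasure X d f \<rho> A \<le> 0" if "0 < \<rho>" for \<rho>
        unfolding hausdorff_premeasure_def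
        by (rule INF_lower2[of "\<lambda>_. X"]) (use \<open>A \<subseteq> X\<close> \<open>X.mbounded X\<close> True that in auto)
      then show ?thesis unfolding hausdorff_measure_def by auto
    qed
    show ?thesis
      using null[OF le_infI1[OF X.mball_subset_mspace]] null[OF X.mball_subset_mspace] by simp
  next
    case False
    define D where "D = mdiam d X"
    have D: "0 < D" using False X.mdiam_nonneg[OF \<open>X.mbounded X\<close>] by (simp add: D_def)
    obtain c C where c: "0 < c" and C: "0 < C"
      and lower: "\<And>p t. \<lbrakk>p \<in> X; 0 < t; t \<le> D\<rbrakk> \<Longrightarrow> ennreal (c * t powr \<delta>) \<le> emeasure \<mu> (X.mball p t)"
      and upper: "\<And>p t. \<lbrakk>p \<in> X; 0 < t; t \<le> D\<rbrakk> \<Longrightarrow> emeasure \<mu> (X.mball p t) \<le> ennreal (C * t powr \<delta>)"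
      using regular unfolding ahlfors_regular_def D_def by blast
    \<comment> \<open>For radii \<open>t\<close> beyond \<open>D\<close>, the added constant gives
      \<open>1 = D powr (- \<delta>) * D powr \<delta> \<le> D powr (- \<delta>) * t powr
      \<delta>\<close>, a bound for any probability.\<close>
    interpret regular_metric_measure X d \<mu> c "C + D powr (- \<delta>)" D \<delta>
    proof
      show "0 < C + D powr (- \<delta>)" using C by (intro add_pos_nonneg) auto
      fix p t assume p: "p \<in> X" and t: "0 < (t :: real)"
      show "c * t powr \<delta> \<le> measure \<mu> (X.mball p t)" if "t \<le> D"
        using lower[OF p t that] c by (simp add: emeasure_eq_measure)
      show "measure \<mu> (X.mball p t) \<le> (C + D powr (- \<delta>)) * t powr \<delta>"
      proof (cases "t \<le> D")
        case True
        have "measure \<mu> (X.mball p t) \<le> C * t powr \<delta>"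
          using upper[OF p t True] C by (simp add: emeasure_eq_measure)
        also have "\<dots> \<le> (C + D powr (- \<delta>)) * t powr \<delta>" by (intro mult_right_mono) auto
        finally show ?thesis .
      next
        case False
        have "measure \<mu> (X.mball p t) \<le> 1" by (rule prob_le_1)
        also have "1 = D powr (- \<delta>) * D powr \<delta>" using D by (simp add: powr_minus)
        also have "\<dots> \<le> (C + D powr (- \<delta>)) * t powr \<delta>"
          using False D delta_pos C by (intro mult_mono powr_mono2) auto
        finally show ?thesis .
      qed
    qed (use c D delta_pos in auto)
    \<comment> \<open>A natural number above the limsup, so that the shift constant is
      nonnegative.\<close>
    obtain C0 :: nat where C0: "limsup (\<lambda>i. ereal (d \<one>\<^bsub>P\<^esub> (\<gamma> i) / f (r i) powr (1 / \<delta>))) < ereal C0"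
      using less_PInf_Ex_of_nat[THEN iffD1, of "limsup (\<lambda>i. ereal (d \<one>\<^bsub>P\<^esub> (\<gamma> i) / f (r i) powr (1 / \<delta>)))"]
        shifts_bounded by auto
    then obtain m where m: "\<And>i. m \<le> i \<Longrightarrow> d \<one>\<^bsub>P\<^esub> (\<gamma> i) / f (r i) powr (1 / \<delta>) < C0"
      using Limsup_lessD[OF C0] unfolding eventually_sequentially by auto
    have shift: "d (x i) (x i \<otimes>\<^bsub>P\<^esub> \<gamma> i) \<le> C0 * f (r i) powr (1 / \<delta>)" if "m \<le> i" for i
    proof -
      have "x i k \<in> carrier (G k)" if "k \<in> {1..n}" for k
        using centres[of i] subset[OF that] that by (auto simp: X_def)
      then have "d (x i) (x i \<otimes>\<^bsub>P\<^esub> \<gamma> i) = d \<one>\<^bsub>P\<^esub> (\<gamma> i)"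
        unfolding d_def P_def using shifts[of i, unfolded P_def] by (intro max_dist_translate group)
      moreover have "0 < f (r i)" using dimension radii_pos by (simp add: dimension_function_def)
      ultimately show ?thesis using m[OF that] by (simp add: divide_less_eq)
    qed
    show ?thesis
      by (rule mass_transference_shifted[OF centres shifted_centres radii_pos radii_tendsto dimension
          monotonic full[unfolded L_def] shift of_nat_0_le_iff complete y])
  qed
qed

end
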